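(* Let $E$ be a locally finite directed graph with no sinks and no sources. Then the gauge action $\gamma$ of $\mathbb T$ on the graph $C^*$-algebra $C^*(E)$ is saturated.
   Context: **Graphs.** A (directed) graph $E=(E^0,E^1,r,s)$ consists of a vertex set $E^0$, an edge set $E^1$ and range and source maps $r,s:E^1\to E^0$. $E$ is row finite if each vertex emits only finitely many edges ($s^{-1}(v)$ is finite for all $v$), and locally finite if moreover each vertex receives only finitely many edges ($r^{-1}(v)$ is finite for all $v$). A sink is a vertex $v$ with $s^{-1}(v)=\emptyset$; a source is a vertex $v$ with $r^{-1}(v)=\emptyset$. **Graph $C^*$-algebra.** For a row finite graph $E$, a Cuntz-Krieger $E$-family is a family $\{s_e,p_v\mid e\in E^1,v\in E^0\}$ where the $s_e$ are partial isometries and the $p_v$ are mutually orthogonal projections with $s_e^*s_e=p_{r(e)}$ for all $e\in E^1$ and $p_v=\sum_{s(e)=v}s_es_e^*$ whenever $s^{-1}(v)\ne\emptyset$. $C^*(E)=C^*(s_e,p_v)$ is the $C^*$-algebra generated by a universal Cuntz-Krieger $E$-family. The gauge action $\gamma$ of $\mathbb T$ on $C^*(E)$ is given by $\gamma_z(s_e)=zs_e$, $\gamma_z(p_v)=p_v$ for $z\in\mathbb T$. **Saturated.** For an action $\alpha$ of a compact group $G$ on a $C^*$-algebra $M$, $C(G,M)$ is a dense $*$-subalgebra of the crossed product $M\times_\alpha G$ with $(f*g)(t)=\int_Gf(s)\alpha_s(g(s^{-1}t))\,ds$ and $f^*(t)=\alpha_t(f(t^{-1})^* )$, where $ds$ is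 normalized Haar measure. For $a,b\in M$ let $f_{a,b}\in C(G,M)$, $f_{a,b}(t)=a\alpha_t(b)$. The action $\alpha$ is saturated if the linear span of $\{f_{a,b}\mid a,b\in M\}$ is dense in $M\times_\alpha G$. *)

theory Defs
  imports
    "HOL-Analysis.Analysis"
    "HOL-Algebra.Module"
    "Graph_Theory.Digraph"
begin

section \<open>C*-algebras\<close>

text \<open>
  C*-algebras (unital or not) occur in two forms. An algebra that is only universally quantified
  over at the outermost level is a type of class \<open>cstar\<close>, so that the integrals and the topology of
  the library apply to it. A universal property quantifies over C*-algebras inside a formula;
  there a C*-algebra is an explicit structure, a record satisfying the locale \<open>cstar_algebra\<close>.
\<close>

class cstar = banach + real_normed_algebra +
  fixes scaleC :: "complex \<Rightarrow> 'a \<Rightarrow> 'a"  (infixr \<open>*\<^sub>C\<close> 75)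
    and star :: "'a \<Rightarrow> 'a"
  assumes scaleC_add_right: "c *\<^sub>C (x + y) = c *\<^sub>C x + c *\<^sub>C y"
    and scaleC_add_left: "(c + d) *\<^sub>C x = c *\<^sub>C x + d *\<^sub>C x"
    and scaleC_scaleC: "c *\<^sub>C d *\<^sub>C x = (c * d) *\<^sub>C x"
    and scaleC_of_real: "complex_of_real r *\<^sub>C x = r *\<^sub>R x"
    and scaleC_mult_left: "(c *\<^sub>C x) * y = c *\<^sub>C (x * y)"
    and scaleC_mult_right: "x * (c *\<^sub>C y) = c *\<^sub>C (x * y)"
    and norm_scaleC: "norm (c *\<^sub>C x) = cmod c * norm x"
    and star_add: "star (x + y) = star x + star y"
    and star_scaleC: "star (c *\<^sub>C x) = cnj c *\<^sub>C star x"
    and star_mult: "star (x * y) = star y * star x"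
    and star_star: "star (star x) = x"
    and cstar_identity: "norm (star x * x) = (norm x)\<^sup>2"

lemma scaleC_one: "1 *\<^sub>C x = (x :: 'a::cstar)"
  using scaleC_of_real[of 1 x] by simp

global_interpretation complex_vector: vector_space "scaleC :: complex \<Rightarrow> 'a \<Rightarrow> 'a::cstar"
  defines cspan = complex_vector.span
  by unfold_locales (simp_all add: scaleC_add_right scaleC_add_left scaleC_scaleC scaleC_one)

text \<open>
  The field \<open>one\<close> inherited from \<^typ>\<open>'a ring\<close> carries no meaning here and is left unspecified.
\<close>

record 'a star_algebra = "(complex, 'a) module" +
  inv_star :: "'a \<Rightarrow> 'a"
  anorm :: "'a \<Rightarrow> real"

locale cstar_algebra = abelian_group B for B :: "('b, 'm) star_algebra_scheme" (structure) +
  assumes smult_closed: "x \<in> carrier B \<Longrightarrow> c \<odot> x \<in> carrier B"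
    and smult_r_distr: "\<lbrakk>x \<in> carrier B; y \<in> carrier B\<rbrakk> \<Longrightarrow> c \<odot> (x \<oplus> y) = c \<odot> x \<oplus> c \<odot> y"
    and smult_l_distr: "x \<in> carrier B \<Longrightarrow> (c + d) \<odot> x = c \<odot> x \<oplus> d \<odot> x"
    and smult_smult: "x \<in> carrier B \<Longrightarrow> c \<odot> (d \<odot> x) = (c * d) \<odot> x"
    and smult_one: "x \<in> carrier B \<Longrightarrow> 1 \<odot> x = x"
    and mult_closed: "\<lbrakk>x \<in> carrier B; y \<in> carrier B\<rbrakk> \<Longrightarrow> x \<otimes> y \<in> carrier B"
    and mult_assoc: "\<lbrakk>x \<in> carrier B; y \<in> carrier B; z \<in> carrier B\<rbrakk>
          \<Longrightarrow> (x \<otimes> y) \<otimes> z = x \<otimes> (y \<otimes> z)"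
    and mult_l_distr: "\<lbrakk>x \<in> carrier B; y \<in> carrier B; z \<in> carrier B\<rbrakk>
          \<Longrightarrow> (x \<oplus> y) \<otimes> z = x \<otimes> z \<oplus> y \<otimes> z"
    and mult_r_distr: "\<lbrakk>x \<in> carrier B; y \<in> carrier B; z \<in> carrier B\<rbrakk>
          \<Longrightarrow> z \<otimes> (x \<oplus> y) = z \<otimes> x \<oplus> z \<otimes> y"
    and smult_mult_left: "\<lbrakk>x \<in> carrier B; y \<in> carrier B\<rbrakk> \<Longrightarrow> (c \<odot> x) \<otimes> y = c \<odot> (x \<otimes> y)"
    and smult_mult_right: "\<lbrakk>x \<in> carrier B; y \<in> carrier B\<rbrakk> \<Longrightarrow> x \<otimes> (c \<odot> y) = c \<odot> (x \<otimes> y)"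
    and star_closed: "x \<in> carrier B \<Longrightarrow> inv_star B x \<in> carrier B"
    and star_add: "\<lbrakk>x \<in> carrier B; y \<in> carrier B\<rbrakk>
          \<Longrightarrow> inv_star B (x \<oplus> y) = inv_star B x \<oplus> inv_star B y"
    and star_smult: "x \<in> carrier B \<Longrightarrow> inv_star B (c \<odot> x) = cnj c \<odot> inv_star B x"
    and star_mult: "\<lbrakk>x \<in> carrier B; y \<in> carrier B\<rbrakk>
          \<Longrightarrow> inv_star B (x \<otimes> y) = inv_star B y \<otimes> inv_star B x"
    and star_star: "x \<in> carrier B \<Longrightarrow> inv_star B (inv_star B x) = x"
    and norm_eq_zero: "x \<in> carrier B \<Longrightarrow> anorm B x = 0 \<longleftrightarrow> x = \<zero>"
    and norm_triangle: "\<lbrakk>x \<in> carrier B; y \<in> carrier B\<rbrakk>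
          \<Longrightarrow> anorm B (x \<oplus> y) \<le> anorm B x + anorm B y"
    and norm_smult: "x \<in> carrier B \<Longrightarrow> anorm B (c \<odot> x) = cmod c * anorm B x"
    and norm_mult: "\<lbrakk>x \<in> carrier B; y \<in> carrier B\<rbrakk> \<Longrightarrow> anorm B (x \<otimes> y) \<le> anorm B x * anorm B y"
    and cstar_identity: "x \<in> carrier B \<Longrightarrow> anorm B (inv_star B x \<otimes> x) = (anorm B x)\<^sup>2"
    and complete: "\<lbrakk>\<And>n::nat. \<sigma> n \<in> carrier B;
            \<And>e. e > 0 \<Longrightarrow> \<exists>N. \<forall>m\<ge>N. \<forall>n\<ge>N. anorm B (\<sigma> m \<ominus> \<sigma> n) < e\<rbrakk>
          \<Longrightarrow> \<exists>x\<in>carrier B. (\<lambda>n. anorm B (\<sigma> n \<ominus> x)) \<longlonglongrightarrow> 0"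

definition type_algebra :: "'a::cstar star_algebra" where
  "type_algebra = \<lparr>carrier = UNIV, mult = (*), one = undefined, zero = 0, add = (+),
     smult = scaleC, inv_star = star, anorm = norm\<rparr>"

definition star_hom ::
  "('a, 'm) star_algebra_scheme \<Rightarrow> ('b, 'n) star_algebra_scheme \<Rightarrow> ('a \<Rightarrow> 'b) \<Rightarrow> bool" where
  "star_hom A B \<phi> \<longleftrightarrow>
     (\<forall>x\<in>carrier A. \<phi> x \<in> carrier B) \<and>
     (\<forall>x\<in>carrier A. \<forall>y\<in>carrier A. \<phi> (x \<oplus>\<^bsub>A\<^esub> y) = \<phi> x \<oplus>\<^bsub>B\<^esub> \<phi> y) \<and>
     (\<forall>c. \<forall>x\<in>carrier A. \<phi> (c \<odot>\<^bsub>A\<^esub> x) = c \<odot>\<^bsub>B\<^esub> \<phi> x) \<and>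
     (\<forall>x\<in>carrier A. \<forall>y\<in>carrier A. \<phi> (x \<otimes>\<^bsub>A\<^esub> y) = \<phi> x \<otimes>\<^bsub>B\<^esub> \<phi> y) \<and>
     (\<forall>x\<in>carrier A. \<phi> (inv_star A x) = inv_star B (\<phi> x))"

definition cstar_generated :: "'a::cstar set \<Rightarrow> 'a set" where
  "cstar_generated S = \<Inter>{A. S \<subseteq> A \<and> closed A \<and> complex_vector.subspace A \<and>
     (\<forall>x\<in>A. \<forall>y\<in>A. x * y \<in> A) \<and> (\<forall>x\<in>A. star x \<in> A)}"

text \<open>
  Formal *-polynomials over an alphabet \<open>'i\<close>. A C*-algebra generated by a family indexed by \<open>'i\<close>
  has at most as many elements as there are sequences of such polynomials. So a universal property
  for such families may be tested on the C*-algebras whose carrier is a subset of the type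
  \<open>nat \<Rightarrow> 'i star_term\<close>, without loss of generality: see the final lemmas \<open>graph_cstar_algebra_universal\<close>
  and \<open>crossed_product_universal\<close>, in which the type of the target algebra is arbitrary.
\<close>

datatype 'i star_term =
    Gen 'i
  | Add "'i star_term" "'i star_term"
  | Scale complex "'i star_term"
  | Mult "'i star_term" "'i star_term"
  | Star "'i star_term"

type_synonym 'i cstar_universe = "nat \<Rightarrow> 'i star_term"


section \<open>Graphs and their C*-algebras\<close>

text \<open>
  For a directed graph \<^term>\<open>E :: ('v, 'e) pre_digraph\<close> the vertices are \<^term>\<open>verts E\<close>, the edges
  \<^term>\<open>arcs E\<close>, the source map is \<^term>\<open>tail E\<close> and the range map is \<^term>\<open>head E\<close>.
\<close>

definition locally_finite_digraph :: "('v, 'e) pre_digraph \<Rightarrow> bool" where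
  "locally_finite_digraph E \<longleftrightarrow> (\<forall>v\<in>verts E. finite (out_arcs E v) \<and> finite (in_arcs E v))"

definition is_sink :: "('v, 'e) pre_digraph \<Rightarrow> 'v \<Rightarrow> bool" where
  "is_sink E v \<longleftrightarrow> v \<in> verts E \<and> out_arcs E v = {}"

definition is_source :: "('v, 'e) pre_digraph \<Rightarrow> 'v \<Rightarrow> bool" where
  "is_source E v \<longleftrightarrow> v \<in> verts E \<and> in_arcs E v = {}"

definition cuntz_krieger_family ::
  "('v, 'e) pre_digraph \<Rightarrow> ('b, 'm) star_algebra_scheme \<Rightarrow> ('e \<Rightarrow> 'b) \<Rightarrow> ('v \<Rightarrow> 'b) \<Rightarrow> bool" where
  "cuntz_krieger_family E B s p \<longleftrightarrow>
     (\<forall>v\<in>verts E. p v \<in> carrier B \<and> p v \<otimes>\<^bsub>B\<^esub> p v = p v \<and> inv_star B (p v) = p v) \<and>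
     (\<forall>v\<in>verts E. \<forall>w\<in>verts E. v \<noteq> w \<longrightarrow> p v \<otimes>\<^bsub>B\<^esub> p w = \<zero>\<^bsub>B\<^esub>) \<and>
     (\<forall>e\<in>arcs E. s e \<in> carrier B \<and> s e \<otimes>\<^bsub>B\<^esub> inv_star B (s e) \<otimes>\<^bsub>B\<^esub> s e = s e) \<and>
     (\<forall>e\<in>arcs E. inv_star B (s e) \<otimes>\<^bsub>B\<^esub> s e = p (head E e)) \<and>
     (\<forall>v\<in>verts E. out_arcs E v \<noteq> {} \<longrightarrow>
        p v = (\<Oplus>\<^bsub>B\<^esub>e\<in>out_arcs E v. s e \<otimes>\<^bsub>B\<^esub> inv_star B (s e)))"

text \<open>
  The type \<^typ>\<open>'a\<close> together with \<open>s\<close> and \<open>p\<close> is the graph C*-algebra of a row finite graph: it is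
  generated by the Cuntz-Krieger family, and the family is universal.
\<close>

definition graph_cstar_algebra ::
  "('v, 'e) pre_digraph \<Rightarrow> ('e \<Rightarrow> 'a::cstar) \<Rightarrow> ('v \<Rightarrow> 'a) \<Rightarrow> bool" where
  "graph_cstar_algebra E s p \<longleftrightarrow>
     cuntz_krieger_family E type_algebra s p \<and>
     cstar_generated (s ` arcs E \<union> p ` verts E) = UNIV \<and>
     (\<forall>(B :: ('v + 'e) cstar_universe star_algebra) t q.
        cstar_algebra B \<and> cuntz_krieger_family E B t q \<longrightarrow>
        (\<exists>\<phi>. star_hom type_algebra B \<phi> \<and>
          (\<forall>e\<in>arcs E. \<phi> (s e) = t e) \<and> (\<forall>v\<in>verts E. \<phi> (p v) = q v)))"


section \<open>Actions of the circle group and crossed products\<close>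

abbreviation circle :: "complex set" where
  "circle \<equiv> sphere 0 1"

definition circle_action :: "(complex \<Rightarrow> 'a \<Rightarrow> 'a::cstar) \<Rightarrow> bool" where
  "circle_action \<alpha> \<longleftrightarrow>
     (\<forall>z\<in>circle. star_hom type_algebra type_algebra (\<alpha> z) \<and> bij (\<alpha> z)) \<and>
     (\<forall>z\<in>circle. \<forall>w\<in>circle. \<alpha> (z * w) = \<alpha> z \<circ> \<alpha> w) \<and>
     (\<forall>x. continuous_on circle (\<lambda>z. \<alpha> z x))"

definition gauge_action ::
  "('v, 'e) pre_digraph \<Rightarrow> ('e \<Rightarrow> 'a::cstar) \<Rightarrow> ('v \<Rightarrow> 'a) \<Rightarrow> (complex \<Rightarrow> 'a \<Rightarrow> 'a) \<Rightarrow> bool" where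
  "gauge_action E s p \<gamma> \<longleftrightarrow> circle_action \<gamma> \<and>
     (\<forall>z\<in>circle. (\<forall>e\<in>arcs E. \<gamma> z (s e) = z *\<^sub>C s e) \<and> (\<forall>v\<in>verts E. \<gamma> z (p v) = p v))"

text \<open>Integration against the normalized Haar measure of the circle group.\<close>

definition circle_integral :: "(complex \<Rightarrow> 'a::banach) \<Rightarrow> 'a" where
  "circle_integral F = integral {0..1} (\<lambda>x. F (cis (2 * pi * x)))"

text \<open>
  The normed *-algebra of continuous functions from the circle to \<^typ>\<open>'a\<close> with the twisted
  convolution and the \<open>L\<^sup>1\<close>-norm; its elements are extended by 0 off the circle.
\<close>

definition convolution_algebra ::
  "(complex \<Rightarrow> 'a \<Rightarrow> 'a::cstar) \<Rightarrow> (complex \<Rightarrow> 'a) star_algebra" where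
  "convolution_algebra \<alpha> =
     \<lparr>carrier = {f. continuous_on circle f \<and> (\<forall>t. t \<notin> circle \<longrightarrow> f t = 0)},
      mult = (\<lambda>f g t. if t \<in> circle
                then circle_integral (\<lambda>u. f u * \<alpha> u (g (inverse u * t))) else 0),
      one = undefined,
      zero = (\<lambda>t. 0),
      add = (\<lambda>f g t. f t + g t),
      smult = (\<lambda>c f t. c *\<^sub>C f t),
      inv_star = (\<lambda>f t. if t \<in> circle then \<alpha> t (star (f (inverse t))) else 0),
      anorm = (\<lambda>f. circle_integral (\<lambda>t. norm (f t)))\<rparr>"

definition L1_contractive ::
  "(complex \<Rightarrow> 'a \<Rightarrow> 'a::cstar) \<Rightarrow> ('b, 'm) star_algebra_scheme
     \<Rightarrow> ((complex \<Rightarrow> 'a) \<Rightarrow> 'b) \<Rightarrow> bool" where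
  "L1_contractive \<alpha> B \<Phi> \<longleftrightarrow>
     (\<forall>f\<in>carrier (convolution_algebra \<alpha>). anorm B (\<Phi> f) \<le> anorm (convolution_algebra \<alpha>) f)"

text \<open>
  The type \<^typ>\<open>'n\<close> with the canonical map \<open>\<iota>\<close> is the crossed product of \<^typ>\<open>'a\<close> by \<open>\<alpha>\<close>: the
  enveloping C*-algebra of the convolution algebra \<open>L\<^sup>1\<close>, of which the continuous functions form a
  dense *-subalgebra. Its universal property is for *-homomorphisms that are contractive
  for the \<open>L\<^sup>1\<close>-norm; these are the ones that extend to \<open>L\<^sup>1\<close>.
\<close>

definition crossed_product ::
  "(complex \<Rightarrow> 'a \<Rightarrow> 'a::cstar) \<Rightarrow> ((complex \<Rightarrow> 'a) \<Rightarrow> 'n::cstar) \<Rightarrow> bool" where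
  "crossed_product \<alpha> \<iota> \<longleftrightarrow>
     star_hom (convolution_algebra \<alpha>) type_algebra \<iota> \<and>
     L1_contractive \<alpha> type_algebra \<iota> \<and>
     closure (\<iota> ` carrier (convolution_algebra \<alpha>)) = UNIV \<and>
     (\<forall>(B :: (complex \<Rightarrow> 'a) cstar_universe star_algebra) \<Phi>.
        cstar_algebra B \<and> star_hom (convolution_algebra \<alpha>) B \<Phi> \<and> L1_contractive \<alpha> B \<Phi> \<longrightarrow>
        (\<exists>\<psi>. star_hom type_algebra B \<psi> \<and>
          (\<forall>f\<in>carrier (convolution_algebra \<alpha>). \<psi> (\<iota> f) = \<Phi> f)))"

definition product_function :: "(complex \<Rightarrow> 'a \<Rightarrow> 'a::cstar) \<Rightarrow> 'a \<Rightarrow> 'a \<Rightarrow> complex \<Rightarrow> 'a" where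
  "product_function \<alpha> a b = (\<lambda>t. if t \<in> circle then a * \<alpha> t b else 0)"

text \<open>Saturation of \<open>\<alpha>\<close>, with respect to its crossed product \<open>\<iota>\<close>.\<close>

definition saturated ::
  "(complex \<Rightarrow> 'a \<Rightarrow> 'a::cstar) \<Rightarrow> ((complex \<Rightarrow> 'a) \<Rightarrow> 'n::cstar) \<Rightarrow> bool" where
  "saturated \<alpha> \<iota> \<longleftrightarrow> closure (cspan {\<iota> (product_function \<alpha> a b) | a b. True}) = UNIV"


section \<open>The universal properties hold for target algebras on any type\<close>

lemma cstar_algebra_type_algebra: "cstar_algebra (type_algebra :: 'a::cstar star_algebra)"
proof -
  let ?A = "type_algebra :: 'a star_algebra"
  have ag: "abelian_group ?A"
  proof (rule abelian_groupI)
    fix x :: 'a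
    show "\<exists>y\<in>carrier ?A. y \<oplus>\<^bsub>?A\<^esub> x = \<zero>\<^bsub>?A\<^esub>"
      by (rule bexI[of _ "- x"]) (simp_all add: type_algebra_def)
  qed (simp_all add: type_algebra_def add.assoc add.commute)
  then interpret abelian_group ?A .
  have neg: "\<ominus>\<^bsub>?A\<^esub> x = - x" for x :: 'a
    by (rule minus_equality) (auto simp: type_algebra_def)
  have minus: "x \<ominus>\<^bsub>?A\<^esub> y = x - y" for x y :: 'a
    by (simp add: a_minus_def neg) (simp add: type_algebra_def)
  show ?thesis
  proof unfold_locales
    fix \<sigma> :: "nat \<Rightarrow> 'a"
    assume "\<And>e. e > 0 \<Longrightarrow> \<exists>N. \<forall>m\<ge>N. \<forall>n\<ge>N. anorm ?A (\<sigma> m \<ominus>\<^bsub>?A\<^esub> \<sigma> n) < e"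
    then have "Cauchy \<sigma>"
      unfolding minus by (intro metric_CauchyI) (simp add: type_algebra_def dist_norm)
    then obtain x where "\<sigma> \<longlonglongrightarrow> x"
      using Cauchy_convergent convergent_def by blast
    then have "(\<lambda>n. norm (\<sigma> n - x)) \<longlonglongrightarrow> 0"
      using LIM_zero tendsto_norm_zero by blast
    then show "\<exists>x\<in>carrier ?A. (\<lambda>n. anorm ?A (\<sigma> n \<ominus>\<^bsub>?A\<^esub> x)) \<longlonglongrightarrow> 0"
      unfolding minus by (auto simp: type_algebra_def)
  qed (simp_all add: type_algebra_def scaleC_add_right scaleC_add_left scaleC_scaleC scaleC_one
        mult.assoc distrib_left distrib_right scaleC_mult_left scaleC_mult_right star_add
        star_scaleC star_mult star_star norm_triangle_ineq norm_scaleC norm_mult_ineq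
        cstar_identity)
qed

context cstar_algebra
begin

lemma smult_zero: "x \<in> carrier B \<Longrightarrow> 0 \<odot> x = \<zero>"
  using norm_smult[of x 0] norm_eq_zero smult_closed by simp

lemma neg_eq: assumes "x \<in> carrier B" shows "\<ominus> x = (- 1) \<odot> x"
proof (rule minus_equality)
  show "(- 1) \<odot> x \<oplus> x = \<zero>"
    using smult_l_distr[of x "- 1" 1] smult_one smult_zero assms by simp
qed (use assms smult_closed in auto)

lemma norm_neg: "x \<in> carrier B \<Longrightarrow> anorm B (\<ominus> x) = anorm B x"
  using neg_eq norm_smult by simp

lemma norm_zero: "anorm B \<zero> = 0"
  using norm_eq_zero by simp

lemma norm_nonneg: assumes "x \<in> carrier B" shows "anorm B x \<ge> 0"
  using norm_triangle[of x "\<ominus> x"] norm_neg norm_zero assms r_neg by simp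

lemma norm_minus_commute:
  assumes "x \<in> carrier B" "y \<in> carrier B" shows "anorm B (x \<ominus> y) = anorm B (y \<ominus> x)"
proof -
  have "\<ominus> (x \<ominus> y) = y \<ominus> x"
    using assms by (simp add: a_minus_def minus_add a_comm)
  then show ?thesis using norm_neg[of "x \<ominus> y"] assms by simp
qed

lemma minus_split:
  assumes "x \<in> carrier B" "y \<in> carrier B" "z \<in> carrier B"
  shows "x \<ominus> z = (x \<ominus> y) \<oplus> (y \<ominus> z)"
proof -
  have "(x \<ominus> y) \<oplus> (y \<ominus> z) = x \<oplus> (\<ominus> y \<oplus> (y \<oplus> \<ominus> z))"
    using assms by (simp add: a_minus_def a_assoc)
  also have "\<dots> = x \<ominus> z" using assms by (simp add: r_neg1 a_minus_def)
  finally show ?thesis by simp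
qed

lemma norm_dist_triangle:
  assumes "x \<in> carrier B" "y \<in> carrier B" "z \<in> carrier B"
  shows "anorm B (x \<ominus> z) \<le> anorm B (x \<ominus> y) + anorm B (y \<ominus> z)"
  using minus_split[OF assms] norm_triangle[of "x \<ominus> y" "y \<ominus> z"] assms by simp

lemma eq_of_norm_minus:
  assumes "x \<in> carrier B" "y \<in> carrier B" "anorm B (x \<ominus> y) = 0" shows "x = y"
proof -
  have "x \<ominus> y = \<zero>" using assms norm_eq_zero by simp
  moreover have "x = (x \<ominus> y) \<oplus> y"
    using assms by (simp add: a_minus_def a_assoc l_neg)
  ultimately show ?thesis using assms by simp
qed

lemma norm_star: assumes "x \<in> carrier B" shows "anorm B (inv_star B x) = anorm B x"
proof -
  have le: "anorm B y \<le> anorm B (inv_star B y)" if y: "y \<in> carrier B" for y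
  proof (cases "anorm B y = 0")
    case False
    then have "anorm B y > 0" using norm_nonneg[OF y] by simp
    moreover have "anorm B y * anorm B y \<le> anorm B (inv_star B y) * anorm B y"
      using cstar_identity[OF y] norm_mult[of "inv_star B y" y] y star_closed
      by (simp add: power2_eq_square)
    ultimately show ?thesis by simp
  qed (use norm_nonneg star_closed y in simp)
  show ?thesis
    using le[OF assms] le[OF star_closed[OF assms]] star_star[OF assms] by simp
qed

end

text \<open>
  A closed *-subalgebra \<open>A\<close> of a C*-algebra, carried over to another type by an injection \<open>j\<close>.
\<close>

definition star_copy :: "('b, 'm) star_algebra_scheme \<Rightarrow> 'b set \<Rightarrow> ('b \<Rightarrow> 'u) \<Rightarrow> 'u star_algebra"
  where
  "star_copy B A j = (let i = inv_into A j in
     \<lparr>carrier = j ` A, mult = (\<lambda>x y. j (i x \<otimes>\<^bsub>B\<^esub> i y)), one = undefined, zero = j \<zero>\<^bsub>B\<^esub>,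
      add = (\<lambda>x y. j (i x \<oplus>\<^bsub>B\<^esub> i y)), smult = (\<lambda>c x. j (c \<odot>\<^bsub>B\<^esub> i x)),
      inv_star = (\<lambda>x. j (inv_star B (i x))), anorm = (\<lambda>x. anorm B (i x))\<rparr>)"

lemma (in cstar_algebra) cstar_algebra_star_copy:
  fixes A :: "'b set" and j :: "'b \<Rightarrow> 'u"
  assumes sub: "A \<subseteq> carrier B" and zero: "\<zero> \<in> A"
    and add: "\<And>x y. \<lbrakk>x \<in> A; y \<in> A\<rbrakk> \<Longrightarrow> x \<oplus> y \<in> A"
    and smult: "\<And>c x. x \<in> A \<Longrightarrow> c \<odot> x \<in> A"
    and mult: "\<And>x y. \<lbrakk>x \<in> A; y \<in> A\<rbrakk> \<Longrightarrow> x \<otimes> y \<in> A"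
    and star: "\<And>x. x \<in> A \<Longrightarrow> inv_star B x \<in> A"
    and lim: "\<And>(\<sigma> :: nat \<Rightarrow> 'b) x. \<lbrakk>\<And>n. \<sigma> n \<in> A; x \<in> carrier B;
        (\<lambda>n. anorm B (\<sigma> n \<ominus> x)) \<longlonglongrightarrow> 0\<rbrakk> \<Longrightarrow> x \<in> A"
    and inj: "inj_on j A"
  shows "cstar_algebra (star_copy B A j)" (is "cstar_algebra ?C")
proof -
  note [simp] = inv_into_f_f[OF inj]
  have car [simp]: "x \<in> A \<Longrightarrow> x \<in> carrier B" for x using sub by blast
  note [simp] = zero add smult mult star
  have C: "carrier ?C = j ` A" "\<zero>\<^bsub>?C\<^esub> = j \<zero>"
    "x \<in> A \<Longrightarrow> y \<in> A \<Longrightarrow> j x \<oplus>\<^bsub>?C\<^esub> j y = j (x \<oplus> y)"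
    "x \<in> A \<Longrightarrow> y \<in> A \<Longrightarrow> j x \<otimes>\<^bsub>?C\<^esub> j y = j (x \<otimes> y)"
    "x \<in> A \<Longrightarrow> c \<odot>\<^bsub>?C\<^esub> j x = j (c \<odot> x)"
    "x \<in> A \<Longrightarrow> inv_star ?C (j x) = j (inv_star B x)"
    "x \<in> A \<Longrightarrow> anorm ?C (j x) = anorm B x" for x y c
    by (simp_all add: star_copy_def Let_def)
  have neg_A [simp]: "\<ominus> x \<in> A" if "x \<in> A" for x
    using smult[OF that, of "- 1"] neg_eq[OF car[OF that]] by simp
  have ag: "abelian_group ?C"
  proof (rule abelian_groupI)
    fix x assume "x \<in> carrier ?C"
    then obtain a where a: "a \<in> A" "x = j a" using C(1) by auto
    then have "j (\<ominus> a) \<oplus>\<^bsub>?C\<^esub> x = \<zero>\<^bsub>?C\<^esub>" by (simp add: C l_neg)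
    then show "\<exists>y\<in>carrier ?C. y \<oplus>\<^bsub>?C\<^esub> x = \<zero>\<^bsub>?C\<^esub>"
      using a C(1) neg_A by blast
  qed (auto simp: C a_assoc a_comm a_lcomm)
  then interpret C: abelian_group ?C .
  have negC: "\<ominus>\<^bsub>?C\<^esub> (j x) = j (\<ominus> x)" if "x \<in> A" for x
    by (rule C.minus_equality) (use that in \<open>simp_all add: C l_neg\<close>)
  have minusC: "j x \<ominus>\<^bsub>?C\<^esub> j y = j (x \<ominus> y)" if "x \<in> A" "y \<in> A" for x y
    using that by (simp add: a_minus_def negC C)
  have minus_A [simp]: "x \<ominus> y \<in> A" if "x \<in> A" "y \<in> A" for x y
    using that by (simp add: a_minus_def)
  show ?thesis
  proof unfold_locales
    fix \<tau> :: "nat \<Rightarrow> 'u"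
    assume \<tau>: "\<And>n. \<tau> n \<in> carrier ?C"
      and cau: "\<And>e. e > 0 \<Longrightarrow> \<exists>N. \<forall>m\<ge>N. \<forall>n\<ge>N. anorm ?C (\<tau> m \<ominus>\<^bsub>?C\<^esub> \<tau> n) < e"
    have "\<forall>n. \<exists>a. a \<in> A \<and> \<tau> n = j a" using \<tau> C(1) by auto
    then obtain \<sigma> where \<sigma>: "\<And>n. \<sigma> n \<in> A" "\<And>n. \<tau> n = j (\<sigma> n)" by metis
    have "\<exists>x\<in>carrier B. (\<lambda>n. anorm B (\<sigma> n \<ominus> x)) \<longlonglongrightarrow> 0"
      by (rule complete) (use \<sigma> cau in \<open>auto simp: minusC C\<close>)
    then obtain x where x: "x \<in> carrier B" "(\<lambda>n. anorm B (\<sigma> n \<ominus> x)) \<longlonglongrightarrow> 0" by blast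
    then have "x \<in> A" using lim \<sigma> by blast
    then show "\<exists>x\<in>carrier ?C. (\<lambda>n. anorm ?C (\<tau> n \<ominus>\<^bsub>?C\<^esub> x)) \<longlonglongrightarrow> 0"
      using x \<sigma> by (intro bexI[of _ "j x"]) (simp_all add: minusC C)
  next
    fix x assume "x \<in> carrier ?C"
    then obtain a where a: "a \<in> A" "x = j a" using C(1) by auto
    then show "anorm ?C x = 0 \<longleftrightarrow> x = \<zero>\<^bsub>?C\<^esub>"
      using inj_on_eq_iff[OF inj, of a \<zero>] by (simp add: C norm_eq_zero)
  qed (auto simp: C smult_r_distr smult_l_distr smult_smult smult_one mult_assoc mult_l_distr
      mult_r_distr smult_mult_left smult_mult_right star_add star_smult star_mult star_star
      norm_triangle norm_smult norm_mult cstar_identity)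
qed

primrec (in cstar_algebra) eval_term :: "('i \<Rightarrow> 'b) \<Rightarrow> 'i star_term \<Rightarrow> 'b" where
  "eval_term g (Gen i) = g i"
| "eval_term g (Add x y) = eval_term g x \<oplus> eval_term g y"
| "eval_term g (Scale c x) = c \<odot> eval_term g x"
| "eval_term g (Mult x y) = eval_term g x \<otimes> eval_term g y"
| "eval_term g (Star x) = inv_star B (eval_term g x)"

lemma (in cstar_algebra) eval_term_closed:
  "(\<And>i. g i \<in> carrier B) \<Longrightarrow> eval_term g x \<in> carrier B"
  by (induction x) (auto intro: smult_closed mult_closed star_closed)

lemma (in cstar_algebra) cstar_generated_copy:
  fixes g :: "'i \<Rightarrow> 'b"
  assumes g: "\<And>i. g i \<in> carrier B"
  shows "\<exists>(C :: 'i cstar_universe star_algebra) h.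
    cstar_algebra C \<and> star_hom C B h \<and> inj_on h (carrier C) \<and>
    (\<forall>x\<in>carrier C. anorm B (h x) = anorm C x) \<and> range g \<subseteq> h ` carrier C"
proof -
  define lim where "lim = (\<lambda>(\<tau> :: 'i cstar_universe) x.
    (\<lambda>n. anorm B (eval_term g (\<tau> n) \<ominus> x)) \<longlonglongrightarrow> 0)"
  define A where "A = {x \<in> carrier B. \<exists>\<tau>. lim \<tau> x}"
  note ev [simp] = eval_term_closed[of g, OF g]
  note [simp] = smult_closed mult_closed star_closed norm_nonneg
  have lim_I: "lim \<tau> x"
    if "F \<longlonglongrightarrow> 0" "\<And>n. anorm B (eval_term g (\<tau> n) \<ominus> x) \<le> F n" "x \<in> carrier B" for \<tau> x and F :: "nat \<Rightarrow> real"
    unfolding lim_def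
    by (rule tendsto_sandwich[OF _ _ tendsto_const that(1)]) (use that in auto)
  have A_I: "x \<in> A" if "x \<in> carrier B" "\<And>e. e > 0 \<Longrightarrow> \<exists>\<tau>. anorm B (eval_term g \<tau> \<ominus> x) < e" for x
  proof -
    have "\<forall>n. \<exists>\<tau>. anorm B (eval_term g \<tau> \<ominus> x) < inverse (real (Suc n))"
      using that(2) by simp
    then obtain \<tau> where "\<And>n. anorm B (eval_term g (\<tau> n) \<ominus> x) < inverse (real (Suc n))" by metis
    then have "lim \<tau> x"
      by (intro lim_I[OF LIMSEQ_inverse_real_of_nat]) (use that in \<open>auto intro: less_imp_le\<close>)
    then show ?thesis using that(1) by (auto simp: A_def)
  qed
  have A_E: "\<exists>\<tau>. anorm B (eval_term g \<tau> \<ominus> x) < e" if "x \<in> A" "e > 0" for x e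
  proof -
    obtain \<tau> where "lim \<tau> x" using \<open>x \<in> A\<close> by (auto simp: A_def)
    then have "\<forall>\<^sub>F n in sequentially. anorm B (eval_term g (\<tau> n) \<ominus> x) < e"
      unfolding lim_def using \<open>e > 0\<close> by (rule order_tendstoD(2))
    then show ?thesis using eventually_happens'[OF sequentially_bot] by blast
  qed
  have ev_A: "eval_term g x \<in> A" for x
    by (rule A_I) (auto intro!: exI[of _ x] simp: r_neg a_minus_def norm_zero)
  have unique: "x = y" if "lim \<tau> x" "lim \<tau> y" "x \<in> carrier B" "y \<in> carrier B" for \<tau> x y
  proof -
    have "(\<lambda>n. anorm B (eval_term g (\<tau> n) \<ominus> x) + anorm B (eval_term g (\<tau> n) \<ominus> y)) \<longlonglongrightarrow> 0 + 0"
      using that(1,2) unfolding lim_def by (rule tendsto_add)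
    moreover have "anorm B (x \<ominus> y) \<le> anorm B (eval_term g (\<tau> n) \<ominus> x) + anorm B (eval_term g (\<tau> n) \<ominus> y)" for n
      using norm_dist_triangle[of x "eval_term g (\<tau> n)" y] norm_minus_commute[of x "eval_term g (\<tau> n)"] that
      by simp
    ultimately have "anorm B (x \<ominus> y) \<le> 0"
      by (intro LIMSEQ_le_const[of _ 0]) auto
    then have "anorm B (x \<ominus> y) = 0" using that by (intro antisym) simp_all
    then show ?thesis using eq_of_norm_minus that by blast
  qed
  define j where "j x = (SOME \<tau>. lim \<tau> x)" for x
  have lim_j: "lim (j x) x" if "x \<in> A" for x
    using that unfolding A_def j_def by (auto intro: someI_ex[of "\<lambda>\<tau>. lim \<tau> x"])
  have inj: "inj_on j A"
  proof (rule inj_onI)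
    fix x y assume "x \<in> A" "y \<in> A" "j x = j y"
    then show "x = y" using unique[of "j x" x y] lim_j[of x] lim_j[of y] by (simp add: A_def)
  qed
  have sub: "A \<subseteq> carrier B" by (auto simp: A_def)
  have AC: "x \<in> carrier B" if "x \<in> A" for x using that sub by blast
  have memI: "x \<in> A" if "x \<in> carrier B" "F \<longlonglongrightarrow> 0"
    "\<And>n. anorm B (eval_term g (\<tau> n) \<ominus> x) \<le> F n" for x \<tau> and F :: "nat \<Rightarrow> real"
    using lim_I[OF that(2,3,1)] that(1) by (auto simp: A_def)
  have g_A: "g i \<in> A" for i using ev_A[of "Gen i"] by simp
  have smult_A: "c \<odot> x \<in> A" if x: "x \<in> A" for c x
  proof (rule memI[of _ "\<lambda>n. cmod c * anorm B (eval_term g (j x n) \<ominus> x)"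
        "\<lambda>n. Scale c (j x n)"])
    show "(\<lambda>n. cmod c * anorm B (eval_term g (j x n) \<ominus> x)) \<longlonglongrightarrow> 0"
      using lim_j[OF x] unfolding lim_def by (rule tendsto_mult_right_zero)
    fix n
    have "c \<odot> (\<ominus> x) = \<ominus> (c \<odot> x)"
      using AC[OF x] by (simp add: neg_eq smult_smult mult.commute)
    then have "c \<odot> eval_term g (j x n) \<ominus> c \<odot> x = c \<odot> (eval_term g (j x n) \<ominus> x)"
      using AC[OF x] by (simp add: a_minus_def smult_r_distr)
    then show "anorm B (eval_term g (Scale c (j x n)) \<ominus> c \<odot> x)
        \<le> cmod c * anorm B (eval_term g (j x n) \<ominus> x)"
      using AC[OF x] by (simp add: norm_smult)
  qed (use AC x in auto)
  have add_A: "x \<oplus> y \<in> A" if x: "x \<in> A" and y: "y \<in> A" for x y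
  proof (rule memI[of _ "\<lambda>n. anorm B (eval_term g (j x n) \<ominus> x) + anorm B (eval_term g (j y n) \<ominus> y)"
        "\<lambda>n. Add (j x n) (j y n)"])
    show "(\<lambda>n. anorm B (eval_term g (j x n) \<ominus> x) + anorm B (eval_term g (j y n) \<ominus> y)) \<longlonglongrightarrow> 0"
      using lim_j[OF x] lim_j[OF y] unfolding lim_def by (rule tendsto_add_zero)
    fix n
    let ?a = "eval_term g (j x n)" and ?b = "eval_term g (j y n)"
    have "(?a \<oplus> ?b) \<ominus> (x \<oplus> y) = (?a \<ominus> x) \<oplus> (?b \<ominus> y)"
      using AC[OF x] AC[OF y] by (simp add: a_minus_def minus_add a_ac)
    then show "anorm B (eval_term g (Add (j x n) (j y n)) \<ominus> (x \<oplus> y))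
        \<le> anorm B (?a \<ominus> x) + anorm B (?b \<ominus> y)"
      using AC[OF x] AC[OF y] by (simp add: norm_triangle)
  qed (use AC x y in auto)
  have mult_A: "x \<otimes> y \<in> A" if x: "x \<in> A" and y: "y \<in> A" for x y
  proof (rule memI[of _ "\<lambda>n. anorm B (eval_term g (j x n) \<ominus> x)
          * (anorm B (eval_term g (j y n) \<ominus> y) + anorm B y)
          + anorm B x * anorm B (eval_term g (j y n) \<ominus> y)"
        "\<lambda>n. Mult (j x n) (j y n)"])
    have "(\<lambda>n. anorm B (eval_term g (j x n) \<ominus> x)
          * (anorm B (eval_term g (j y n) \<ominus> y) + anorm B y)
          + anorm B x * anorm B (eval_term g (j y n) \<ominus> y)) \<longlonglongrightarrow> 0 * (0 + anorm B y) + anorm B x * 0"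
      using lim_j[OF x] lim_j[OF y] unfolding lim_def by (intro tendsto_intros)
    then show "(\<lambda>n. anorm B (eval_term g (j x n) \<ominus> x)
          * (anorm B (eval_term g (j y n) \<ominus> y) + anorm B y)
          + anorm B x * anorm B (eval_term g (j y n) \<ominus> y)) \<longlonglongrightarrow> 0" by simp
    fix n
    let ?a = "eval_term g (j x n)" and ?b = "eval_term g (j y n)"
    note xy = AC[OF x] AC[OF y]
    have neg_l: "(\<ominus> u) \<otimes> v = \<ominus> (u \<otimes> v)" and neg_r: "u \<otimes> (\<ominus> v) = \<ominus> (u \<otimes> v)"
      if "u \<in> carrier B" "v \<in> carrier B" for u v
      using that by (simp_all add: neg_eq smult_mult_left smult_mult_right)
    have b: "anorm B ?b \<le> anorm B (?b \<ominus> y) + anorm B y"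
    proof -
      have "?b = (?b \<ominus> y) \<oplus> y" using xy by (simp add: a_minus_def a_assoc l_neg)
      then show ?thesis using norm_triangle[of "?b \<ominus> y" y] xy by simp
    qed
    have "?a \<otimes> ?b \<ominus> x \<otimes> y = (?a \<otimes> ?b \<ominus> x \<otimes> ?b) \<oplus> (x \<otimes> ?b \<ominus> x \<otimes> y)"
      using xy by (intro minus_split) auto
    also have "\<dots> = (?a \<ominus> x) \<otimes> ?b \<oplus> x \<otimes> (?b \<ominus> y)"
      using xy by (simp add: a_minus_def mult_l_distr mult_r_distr neg_l neg_r)
    finally have "anorm B (?a \<otimes> ?b \<ominus> x \<otimes> y)
        \<le> anorm B ((?a \<ominus> x) \<otimes> ?b) + anorm B (x \<otimes> (?b \<ominus> y))"
      using norm_triangle xy by simp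
    also have "\<dots> \<le> anorm B (?a \<ominus> x) * anorm B ?b + anorm B x * anorm B (?b \<ominus> y)"
      using xy by (intro add_mono norm_mult) auto
    also have "\<dots> \<le> anorm B (?a \<ominus> x) * (anorm B (?b \<ominus> y) + anorm B y) + anorm B x * anorm B (?b \<ominus> y)"
      using xy b by (intro add_mono mult_left_mono) auto
    finally show "anorm B (eval_term g (Mult (j x n) (j y n)) \<ominus> x \<otimes> y)
        \<le> anorm B (?a \<ominus> x) * (anorm B (?b \<ominus> y) + anorm B y) + anorm B x * anorm B (?b \<ominus> y)"
      by simp
  qed (use AC x y in auto)
  have star_A: "inv_star B x \<in> A" if x: "x \<in> A" for x
  proof (rule memI[of _ "\<lambda>n. anorm B (eval_term g (j x n) \<ominus> x)"
        "\<lambda>n. Star (j x n)"])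
    show "(\<lambda>n. anorm B (eval_term g (j x n) \<ominus> x)) \<longlonglongrightarrow> 0"
      using lim_j[OF x] unfolding lim_def .
    fix n
    have "inv_star B (eval_term g (j x n)) \<ominus> inv_star B x = inv_star B (eval_term g (j x n) \<ominus> x)"
      using AC[OF x] by (simp add: a_minus_def star_add neg_eq star_smult)
    then show "anorm B (eval_term g (Star (j x n)) \<ominus> inv_star B x)
        \<le> anorm B (eval_term g (j x n) \<ominus> x)"
      using AC[OF x] by (simp add: norm_star)
  qed (use AC x in auto)
  have zero_A: "\<zero> \<in> A"
    using smult_A[OF g_A, of 0] smult_zero[OF g] by simp
  have lim_A: "x \<in> A" if \<sigma>: "\<And>n. \<sigma> n \<in> A" and x: "x \<in> carrier B"
      and tends: "(\<lambda>n. anorm B (\<sigma> n \<ominus> x)) \<longlonglongrightarrow> 0" for \<sigma> :: "nat \<Rightarrow> 'b" and x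
  proof (rule A_I[OF x])
    fix e :: real assume "e > 0"
    then have "\<forall>\<^sub>F n in sequentially. anorm B (\<sigma> n \<ominus> x) < e / 2"
      using tends by (intro order_tendstoD(2)) auto
    then obtain n where n: "anorm B (\<sigma> n \<ominus> x) < e / 2"
      using eventually_happens'[OF sequentially_bot] by blast
    obtain \<tau> where \<tau>: "anorm B (eval_term g \<tau> \<ominus> \<sigma> n) < e / 2"
      using A_E[OF \<sigma>, of "e / 2"] \<open>e > 0\<close> by auto
    have "anorm B (eval_term g \<tau> \<ominus> x) < e"
      using norm_dist_triangle[OF ev AC[OF \<sigma>] x, of \<tau> n] n \<tau> by linarith
    then show "\<exists>\<tau>. anorm B (eval_term g \<tau> \<ominus> x) < e" by blast
  qed
  let ?C = "star_copy B A j" and ?h = "inv_into A j"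
  have "cstar_algebra ?C"
    by (rule cstar_algebra_star_copy[OF sub zero_A add_A smult_A mult_A star_A lim_A inj])
  moreover have h: "?h (j x) = x" if "x \<in> A" for x using inv_into_f_f[OF inj that] .
  then have "star_hom ?C B ?h"
    unfolding star_hom_def star_copy_def Let_def
    using add_A smult_A mult_A star_A AC by simp
  moreover have "inj_on ?h (carrier ?C)"
    by (simp add: star_copy_def Let_def inj_on_inv_into)
  moreover have "\<forall>x\<in>carrier ?C. anorm B (?h x) = anorm ?C x"
    by (simp add: star_copy_def Let_def)
  moreover have "range g \<subseteq> ?h ` carrier ?C"
  proof
    fix x assume "x \<in> range g"
    then have "x \<in> A" using g_A by auto
    then show "x \<in> ?h ` carrier ?C"
      using h[of x] by (auto simp: star_copy_def Let_def image_iff intro!: bexI[of _ x])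
  qed
  ultimately show ?thesis by blast
qed

lemma star_hom_zero:
  assumes "cstar_algebra C" "cstar_algebra B" "star_hom C B h"
  shows "h \<zero>\<^bsub>C\<^esub> = \<zero>\<^bsub>B\<^esub>"
proof -
  interpret C: cstar_algebra C by fact
  interpret B: cstar_algebra B by fact
  have "h (0 \<odot>\<^bsub>C\<^esub> \<zero>\<^bsub>C\<^esub>) = 0 \<odot>\<^bsub>B\<^esub> h \<zero>\<^bsub>C\<^esub>" "h \<zero>\<^bsub>C\<^esub> \<in> carrier B"
    using assms(3) C.zero_closed unfolding star_hom_def by blast+
  then show ?thesis using C.smult_zero[OF C.zero_closed] B.smult_zero by simp
qed

lemma star_hom_finsum:
  assumes "cstar_algebra C" "cstar_algebra B" "star_hom C B h"
    and "\<And>i. i \<in> S \<Longrightarrow> f i \<in> carrier C"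
  shows "h (\<Oplus>\<^bsub>C\<^esub>i\<in>S. f i) = (\<Oplus>\<^bsub>B\<^esub>i\<in>S. h (f i))"
proof -
  interpret C: cstar_algebra C by fact
  interpret B: cstar_algebra B by fact
  have h: "h x \<in> carrier B" if "x \<in> carrier C" for x
    using assms(3) that unfolding star_hom_def by blast
  have h_add: "h (x \<oplus>\<^bsub>C\<^esub> y) = h x \<oplus>\<^bsub>B\<^esub> h y" if "x \<in> carrier C" "y \<in> carrier C" for x y
    using assms(3) that unfolding star_hom_def by blast
  show ?thesis
    using assms(4)
  proof (induction S rule: infinite_finite_induct)
    case (infinite S)
    then show ?case by (simp add: C.finsum_infinite B.finsum_infinite star_hom_zero[OF assms(1-3)])
  next
    case empty
    then show ?case by (simp add: star_hom_zero[OF assms(1-3)])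
  next
    case (insert i S)
    have f: "f \<in> S \<rightarrow> carrier C" "f i \<in> carrier C" using insert.prems by auto
    then have hf: "(\<lambda>i. h (f i)) \<in> S \<rightarrow> carrier B" "h (f i) \<in> carrier B" using h by auto
    show ?case
      using insert f hf C.finsum_closed[OF f(1)]
      by (simp add: C.finsum_insert B.finsum_insert h_add)
  qed
qed

lemma finsum_type_algebra:
  fixes f :: "'i \<Rightarrow> 'a::cstar"
  shows "(\<Oplus>\<^bsub>type_algebra\<^esub>i\<in>S. f i) = (\<Sum>i\<in>S. f i)"
proof -
  interpret cstar_algebra "type_algebra :: 'a star_algebra"
    by (rule cstar_algebra_type_algebra)
  have [simp]: "\<zero>\<^bsub>type_algebra\<^esub> = (0 :: 'a)" "x \<oplus>\<^bsub>type_algebra\<^esub> y = x + y" for x y :: 'a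
    by (simp_all add: type_algebra_def)
  have car: "F \<in> X \<rightarrow> carrier type_algebra" for F :: "'i \<Rightarrow> 'a" and X
    by (simp add: type_algebra_def)
  show ?thesis
  proof (induction S rule: infinite_finite_induct)
    case (insert i S)
    then show ?case using finsum_insert[of S i f] car by (simp add: type_algebra_def)
  qed (simp_all add: finsum_infinite)
qed

lemma cuntz_krieger_family_type_algebra:
  fixes s :: "'e \<Rightarrow> 'a::cstar"
  shows "cuntz_krieger_family E type_algebra s p \<longleftrightarrow>
     (\<forall>v\<in>verts E. p v * p v = p v \<and> star (p v) = p v) \<and>
     (\<forall>v\<in>verts E. \<forall>w\<in>verts E. v \<noteq> w \<longrightarrow> p v * p w = 0) \<and>
     (\<forall>e\<in>arcs E. s e * star (s e) * s e = s e) \<and>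
     (\<forall>e\<in>arcs E. star (s e) * s e = p (head E e)) \<and>
     (\<forall>v\<in>verts E. out_arcs E v \<noteq> {} \<longrightarrow> p v = (\<Sum>e\<in>out_arcs E v. s e * star (s e)))"
  unfolding cuntz_krieger_family_def finsum_type_algebra by (simp add: type_algebra_def)

lemma cuntz_krieger_family_reflect:
  assumes C: "cstar_algebra C" and B: "cstar_algebra B" and h: "star_hom C B h"
    and inj: "inj_on h (carrier C)" and wf: "wf_digraph E"
    and t: "\<And>e. e \<in> arcs E \<Longrightarrow> t' e \<in> carrier C \<and> h (t' e) = t e"
    and q: "\<And>v. v \<in> verts E \<Longrightarrow> q' v \<in> carrier C \<and> h (q' v) = q v"
    and CK: "cuntz_krieger_family E B t q"
  shows "cuntz_krieger_family E C t' q'"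
proof -
  interpret C: cstar_algebra C by fact
  interpret wf_digraph E by fact
  have h_mult: "h (x \<otimes>\<^bsub>C\<^esub> y) = h x \<otimes>\<^bsub>B\<^esub> h y" if "x \<in> carrier C" "y \<in> carrier C" for x y
    using h that unfolding star_hom_def by blast
  have h_star: "h (inv_star C x) = inv_star B (h x)" if "x \<in> carrier C" for x
    using h that unfolding star_hom_def by blast
  have eq: "x = y" if "h x = h y" "x \<in> carrier C" "y \<in> carrier C" for x y
    using that inj by (auto dest: inj_onD)
  note [simp] = C.mult_closed C.star_closed h_mult h_star star_hom_zero[OF C B h] t q
  note CK' = CK[unfolded cuntz_krieger_family_def]
  have arc: "e \<in> arcs E" if "e \<in> out_arcs E v" for e v using that by simp
  have sum: "h (\<Oplus>\<^bsub>C\<^esub>e\<in>out_arcs E v. t' e \<otimes>\<^bsub>C\<^esub> inv_star C (t' e))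
      = (\<Oplus>\<^bsub>B\<^esub>e\<in>out_arcs E v. t e \<otimes>\<^bsub>B\<^esub> inv_star B (t e))" for v
  proof -
    interpret B: cstar_algebra B by fact
    have "h (\<Oplus>\<^bsub>C\<^esub>e\<in>out_arcs E v. t' e \<otimes>\<^bsub>C\<^esub> inv_star C (t' e))
        = (\<Oplus>\<^bsub>B\<^esub>e\<in>out_arcs E v. h (t' e \<otimes>\<^bsub>C\<^esub> inv_star C (t' e)))"
      by (rule star_hom_finsum[OF C B h]) simp
    also have "\<dots> = (\<Oplus>\<^bsub>B\<^esub>e\<in>out_arcs E v. t e \<otimes>\<^bsub>B\<^esub> inv_star B (t e))"
      using CK' by (intro B.finsum_cong') (simp_all add: B.mult_closed B.star_closed Pi_def)
    finally show ?thesis .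
  qed
  show ?thesis
    unfolding cuntz_krieger_family_def
  proof (intro conjI ballI impI)
    fix v assume v: "v \<in> verts E" "out_arcs E v \<noteq> {}"
    show "q' v = (\<Oplus>\<^bsub>C\<^esub>e\<in>out_arcs E v. t' e \<otimes>\<^bsub>C\<^esub> inv_star C (t' e))"
      using CK' v by (intro eq) (auto simp: sum intro!: C.finsum_closed)
  next
    fix v w assume "v \<in> verts E" "w \<in> verts E" "v \<noteq> w"
    then show "q' v \<otimes>\<^bsub>C\<^esub> q' w = \<zero>\<^bsub>C\<^esub>" using CK' by (intro eq) auto
  qed (use CK' in \<open>auto intro!: eq\<close>)
qed

lemma star_hom_compose:
  assumes "star_hom A C \<phi>" "star_hom C B h"
  shows "star_hom A B (h \<circ> \<phi>)"
  using assms unfolding star_hom_def by simp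

text \<open>The universal property of the graph C*-algebra, for target algebras on any type.\<close>

lemma graph_cstar_algebra_universal:
  fixes B :: "('b, 'm) star_algebra_scheme"
  assumes G: "graph_cstar_algebra E s p" and wf: "wf_digraph E"
    and B: "cstar_algebra B" and CK: "cuntz_krieger_family E B t q"
  shows "\<exists>\<phi>. star_hom type_algebra B \<phi> \<and>
    (\<forall>e\<in>arcs E. \<phi> (s e) = t e) \<and> (\<forall>v\<in>verts E. \<phi> (p v) = q v)"
proof -
  interpret B: cstar_algebra B by fact
  define g where "g i = (case i of Inl v \<Rightarrow> if v \<in> verts E then q v else \<zero>\<^bsub>B\<^esub>
    | Inr e \<Rightarrow> if e \<in> arcs E then t e else \<zero>\<^bsub>B\<^esub>)" for i
  have "g i \<in> carrier B" for i
    using CK unfolding cuntz_krieger_family_def g_def by (auto split: sum.split)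
  then obtain C :: "('a + 'c) cstar_universe star_algebra" and h where C: "cstar_algebra C"
    and h: "star_hom C B h" and inj: "inj_on h (carrier C)" and ran: "range g \<subseteq> h ` carrier C"
    using B.cstar_generated_copy[of g] by blast
  have "\<forall>i. \<exists>c. c \<in> carrier C \<and> h c = g i"
  proof
    fix i
    have "g i \<in> h ` carrier C" using ran by auto
    then show "\<exists>c. c \<in> carrier C \<and> h c = g i" by auto
  qed
  then obtain k where k: "\<And>i. k i \<in> carrier C" "\<And>i. h (k i) = g i" by metis
  have "cuntz_krieger_family E C (\<lambda>e. k (Inr e)) (\<lambda>v. k (Inl v))"
    by (rule cuntz_krieger_family_reflect[OF C B h inj wf _ _ CK]) (simp_all add: k g_def)
  then obtain \<phi> where \<phi>: "star_hom type_algebra C \<phi>"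
    "\<forall>e\<in>arcs E. \<phi> (s e) = k (Inr e)" "\<forall>v\<in>verts E. \<phi> (p v) = k (Inl v)"
    using G C unfolding graph_cstar_algebra_def by blast
  then show ?thesis
    using star_hom_compose[OF \<phi>(1) h] by (intro exI[of _ "h \<circ> \<phi>"]) (simp add: k g_def)
qed

text \<open>The universal property of the crossed product, for target algebras on any type.\<close>

lemma crossed_product_universal:
  fixes B :: "('b, 'm) star_algebra_scheme" and \<alpha> :: "complex \<Rightarrow> 'a \<Rightarrow> 'a::cstar"
  assumes X: "crossed_product \<alpha> \<iota>" and B: "cstar_algebra B"
    and \<Phi>: "star_hom (convolution_algebra \<alpha>) B \<Phi>" "L1_contractive \<alpha> B \<Phi>"
  shows "\<exists>\<psi>. star_hom type_algebra B \<psi> \<and>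
    (\<forall>f\<in>carrier (convolution_algebra \<alpha>). \<psi> (\<iota> f) = \<Phi> f)"
proof -
  interpret B: cstar_algebra B by fact
  let ?K = "convolution_algebra \<alpha>"
  define g where "g f = (if \<Phi> f \<in> carrier B then \<Phi> f else \<zero>\<^bsub>B\<^esub>)" for f
  have "g f \<in> carrier B" for f by (simp add: g_def)
  then obtain C :: "(complex \<Rightarrow> 'a) cstar_universe star_algebra" and h where C: "cstar_algebra C"
    and h: "star_hom C B h" and inj: "inj_on h (carrier C)"
    and iso: "\<forall>x\<in>carrier C. anorm B (h x) = anorm C x" and ran: "range g \<subseteq> h ` carrier C"
    using B.cstar_generated_copy[of g] by blast
  interpret C: cstar_algebra C by fact
  have "\<forall>f. \<exists>c. c \<in> carrier C \<and> h c = g f"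
  proof
    fix f
    have "g f \<in> h ` carrier C" using ran by auto
    then show "\<exists>c. c \<in> carrier C \<and> h c = g f" by auto
  qed
  then obtain k where k: "\<And>f. k f \<in> carrier C" "\<And>f. h (k f) = g f" by metis
  note \<Phi>' = \<Phi>(1)[unfolded star_hom_def]
  have g: "g f = \<Phi> f" if "f \<in> carrier ?K" for f
    using that \<Phi>' by (simp add: g_def)
  have eq: "x = y" if "h x = h y" "x \<in> carrier C" "y \<in> carrier C" for x y
    using that inj by (auto dest: inj_onD)
  note ops = B.add.m_closed B.smult_closed B.mult_closed B.star_closed
    C.add.m_closed C.smult_closed C.mult_closed C.star_closed
  have h_ops: "h (x \<oplus>\<^bsub>C\<^esub> y) = h x \<oplus>\<^bsub>B\<^esub> h y" "h (x \<otimes>\<^bsub>C\<^esub> y) = h x \<otimes>\<^bsub>B\<^esub> h y"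
      "h (c \<odot>\<^bsub>C\<^esub> x) = c \<odot>\<^bsub>B\<^esub> h x" "h (inv_star C x) = inv_star B (h x)"
    if "x \<in> carrier C" "y \<in> carrier C" for x y c
    using h that unfolding star_hom_def by blast+
  have "star_hom ?K C k"
    unfolding star_hom_def
  proof (intro conjI ballI allI)
    fix f1 f2 c assume f: "f1 \<in> carrier ?K" "f2 \<in> carrier ?K"
    show "k (f1 \<oplus>\<^bsub>?K\<^esub> f2) = k f1 \<oplus>\<^bsub>C\<^esub> k f2"
      by (rule eq) (use f \<Phi>' in \<open>simp_all add: k h_ops ops g_def\<close>)
    show "k (f1 \<otimes>\<^bsub>?K\<^esub> f2) = k f1 \<otimes>\<^bsub>C\<^esub> k f2"
      by (rule eq) (use f \<Phi>' in \<open>simp_all add: k h_ops ops g_def\<close>)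
  next
    fix f c assume f: "f \<in> carrier ?K"
    show "k (c \<odot>\<^bsub>?K\<^esub> f) = c \<odot>\<^bsub>C\<^esub> k f"
      by (rule eq) (use f \<Phi>' in \<open>simp_all add: k h_ops[OF k(1) k(1)] ops g_def\<close>)
    show "k (inv_star ?K f) = inv_star C (k f)"
      by (rule eq) (use f \<Phi>' in \<open>simp_all add: k h_ops[OF k(1) k(1)] ops g_def\<close>)
  qed (rule k)
  moreover have "L1_contractive \<alpha> C k"
    unfolding L1_contractive_def
  proof
    fix f assume f: "f \<in> carrier ?K"
    have "anorm C (k f) = anorm B (\<Phi> f)" using iso k g[OF f] by metis
    then show "anorm C (k f) \<le> anorm ?K f" using \<Phi>(2) f by (simp add: L1_contractive_def)
  qed
  ultimately obtain \<psi> where \<psi>: "star_hom type_algebra C \<psi>" "\<forall>f\<in>carrier ?K. \<psi> (\<iota> f) = k f"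
    using X C unfolding crossed_product_def by blast
  then show ?thesis
    using star_hom_compose[OF \<psi>(1) h] by (intro exI[of _ "h \<circ> \<psi>"]) (simp add: k g)
qed

end

theory Submission
  imports Defs
begin

text \<open>
  If \<open>b\<close> lies in the \<open>n\<close>-th spectral subspace of \<open>\<gamma>\<close>, then \<open>f\<^bsub>a,b\<^esub>(t) = t\<^sup>n ab\<close>. So it is enough
  that for each \<open>n\<close> the products \<open>ab\<close> of this kind span a dense subspace, because functions
  \<open>\<Sum> t\<^sup>n x\<^sub>n\<close> are uniformly dense among the continuous ones and the canonical map is \<open>L\<^sup>1\<close>-contractive.
  These spans are left ideals, and they contain every \<open>x p\<^sub>v\<close>: for \<open>n > 0\<close> as there are no sources,
  for \<open>n < 0\<close> as there are no sinks and each vertex emits finitely many edges.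

  Density needs \<open>p\<^sub>v s\<^sub>e = s\<^sub>e\<close> for \<open>v\<close> the source of \<open>e\<close>, that is, a summand \<open>q\<close> of a projection \<open>p\<close>
  that is a sum of projections satisfies \<open>q \<le> p\<close>. In place of the theory of positive elements, this
  is derived from the fact that the unit \<open>q\<close> of the corner of \<open>q\<close> is not the midpoint of \<open>q + k\<close> and
  \<open>q - k\<close>, both of norm at most 1, for a self-adjoint \<open>k \<noteq> 0\<close>.
\<close>

section \<open>Elementary facts on C*-algebras\<close>

lemma star_zero [simp]: "star (0 :: 'a::cstar) = 0"
  using star_add[of "0 :: 'a" 0] by simp

lemma norm_star: "norm (star x) = norm (x :: 'a::cstar)"
proof -
  have le: "norm y \<le> norm (star y)" for y :: 'a
  proof (cases "y = 0")
    case False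
    have "norm y * norm y \<le> norm (star y) * norm y"
      using norm_mult_ineq[of "star y" y] by (simp add: cstar_identity power2_eq_square)
    then show ?thesis using False by simp
  qed simp
  show ?thesis using le[of x] le[of "star x"] by (simp add: star_star)
qed

lemma star_scaleR: "star (r *\<^sub>R x) = r *\<^sub>R star (x :: 'a::cstar)"
  by (simp flip: scaleC_of_real add: star_scaleC)

lemma bounded_linear_star: "bounded_linear (star :: 'a::cstar \<Rightarrow> 'a)"
  by (rule bounded_linear_intro[where K = 1]) (simp_all add: star_add star_scaleR norm_star)

lemmas linear_star = bounded_linear.linear[OF bounded_linear_star]

lemmas star_diff = linear_diff[OF linear_star]

lemma bounded_bilinear_scaleC: "bounded_bilinear (scaleC :: complex \<Rightarrow> 'a::cstar \<Rightarrow> 'a)"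
proof
  show "(r *\<^sub>R c) *\<^sub>C x = r *\<^sub>R (c *\<^sub>C x)" for r c and x :: 'a
    by (simp only: scaleR_conv_of_real scaleC_of_real[symmetric] scaleC_scaleC)
  show "c *\<^sub>C (r *\<^sub>R x) = r *\<^sub>R (c *\<^sub>C x)" for r c and x :: 'a
    by (simp only: scaleC_of_real[symmetric] scaleC_scaleC mult.commute)
  show "\<exists>K. \<forall>c (x :: 'a). norm (c *\<^sub>C x) \<le> norm c * norm x * K"
    by (rule exI[of _ 1]) (simp add: norm_scaleC)
qed (simp_all add: scaleC_add_left scaleC_add_right)

lemmas continuous_on_scaleC [continuous_intros] =
  bounded_bilinear.continuous_on[OF bounded_bilinear_scaleC]

lemma subspace_closure:
  fixes S :: "'a::cstar set"
  assumes "complex_vector.subspace S"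
  shows "complex_vector.subspace (closure S)"
  unfolding complex_vector.subspace_def
proof (intro conjI allI ballI)
  show "0 \<in> closure S"
    using assms complex_vector.subspace_0 closure_subset by blast
next
  fix x y assume "x \<in> closure S" "y \<in> closure S"
  then obtain f g where "\<And>n. f n \<in> S" "\<And>n. g n \<in> S" "f \<longlonglongrightarrow> x" "g \<longlonglongrightarrow> y"
    unfolding closure_sequential by blast
  then show "x + y \<in> closure S"
    unfolding closure_sequential using complex_vector.subspace_add[OF assms]
    by (intro exI[of _ "\<lambda>n. f n + g n"]) (simp add: tendsto_add)
next
  fix c and x assume "x \<in> closure S"
  then obtain f where "\<And>n. f n \<in> S" "f \<longlonglongrightarrow> x"
    unfolding closure_sequential by blast
  then show "c *\<^sub>C x \<in> closure S"
    unfolding closure_sequential using complex_vector.subspace_scale[OF assms]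
    by (intro exI[of _ "\<lambda>n. c *\<^sub>C f n"])
      (simp add: bounded_bilinear.tendsto[OF bounded_bilinear_scaleC])
qed

section \<open>Projections whose sum is a projection\<close>

text \<open>For a projection the C*-identity reads \<open>norm q = (norm q)^2\<close>.\<close>

lemma norm_projection_le_one:
  fixes q :: "'a::cstar"
  assumes "star q = q" "q * q = q"
  shows "norm q \<le> 1"
  using cstar_identity[of q] assms by (cases "q = 0") (simp_all add: power2_eq_square)

text \<open>Left multiplication by the self-adjoint unitary \<open>1 - 2 q\<close>, written without
  a unit. It leaves \<open>star x * x\<close> unchanged, so the C*-identity makes it
  isometric.\<close>

lemma norm_reflection:
  fixes q x :: "'a::cstar"
  assumes "star q = q" "q * q = q"
  shows "norm (x - 2 *\<^sub>R (q * x)) = norm x"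
proof -
  have qq: "q * (q * x) = q * x" using assms(2) by (simp flip: mult.assoc)
  have "star (x - 2 *\<^sub>R (q * x)) * (x - 2 *\<^sub>R (q * x)) = star x * x"
    by (simp add: star_diff star_scaleR star_mult assms(1) algebra_simps qq)
      (simp flip: scaleR_add_left)
  then have "(norm (x - 2 *\<^sub>R (q * x)))\<^sup>2 = (norm x)\<^sup>2"
    using cstar_identity[of "x - 2 *\<^sub>R (q * x)"] cstar_identity[of x] by simp
  then show ?thesis by simp
qed

text \<open>The element is \<open>r (1 - 2 q) r\<close>, a compression of the reflection in
  \<open>q\<close> to the corner of \<open>r\<close>.\<close>

lemma norm_compressed_reflection_le_one:
  fixes q r :: "'a::cstar"
  assumes "star q = q" "q * q = q" "star r = r" "r * r = r"
  shows "norm (r - 2 *\<^sub>R (r * q * r)) \<le> 1"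
proof -
  have "r - 2 *\<^sub>R (r * q * r) = r * (r - 2 *\<^sub>R (q * r))"
    using assms by (simp add: right_diff_distrib mult.assoc)
  also have "norm \<dots> \<le> norm r * norm (r - 2 *\<^sub>R (q * r))" by (rule norm_mult_ineq)
  also have "\<dots> = norm r * norm r" using norm_reflection assms by metis
  also have "\<dots> \<le> 1"
    using norm_projection_le_one[of r] assms mult_mono[of "norm r" 1 "norm r" 1] by simp
  finally show ?thesis .
qed

lemma norm_mult_le_one:
  fixes x y :: "'a::real_normed_algebra"
  assumes "norm x \<le> 1" "norm y \<le> 1"
  shows "norm (x * y) \<le> 1"
  using norm_mult_ineq[of x y] mult_mono[of "norm x" 1 "norm y" 1] assms by simp

lemma norm_convex_le_one:
  fixes x y :: "'a::real_normed_vector"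
  assumes "norm x \<le> 1" "norm y \<le> 1" "0 \<le> u" "u \<le> 1"
  shows "norm (u *\<^sub>R x + (1 - u) *\<^sub>R y) \<le> 1"
  using convexD[OF convex_cball[of 0 1], of x y u "1 - u"] assms by simp

text \<open>
  With \<open>y = r + cis (pi/4) k\<close>, the square of \<open>y\<close> and that of its adjoint have the mean
  \<open>r + sqrt 2 k\<close>, and the norm of \<open>y\<close> is at most 1 by the C*-identity.
\<close>

lemma corner_unit_step:
  fixes r k :: "'a::cstar"
  assumes r: "star r = r" "r * r = r" and k: "star k = k" "r * k = k" "k * r = k"
    and le: "norm (r + k) \<le> 1" "norm (r - k) \<le> 1"
  shows "norm (r + sqrt 2 *\<^sub>R k) \<le> 1"
proof -
  have ex: "(r + a *\<^sub>C k) * (r + b *\<^sub>C k) = r + (a + b) *\<^sub>C k + (a * b) *\<^sub>C (k * k)" for a b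
    using r(2) k(2,3)
    by (simp add: distrib_left distrib_right scaleC_mult_left scaleC_mult_right scaleC_add_left
        scaleC_add_right scaleC_scaleC mult.commute add_ac)
  have ex1: "(r + k) * (r + k) = r + 2 *\<^sub>R k + k * k"
    using r(2) k(2,3) by (simp add: distrib_left distrib_right scaleR_2 add_ac)
  have ex2: "(r - k) * (r - k) = r - 2 *\<^sub>R k + k * k"
    using r(2) k(2,3) by (simp add: left_diff_distrib right_diff_distrib scaleR_2)
  \<comment> \<open>\<open>c\<close> is \<open>cis (pi/4)\<close> in coordinates. Its square is
    imaginary, so the quadratic terms of \<open>y * y + star y * star y\<close> cancel.\<close>
  define c where "c = Complex (1 / sqrt 2) (1 / sqrt 2)"
  define y where "y = r + c *\<^sub>C k"
  have c: "c + cnj c = of_real (sqrt 2)" "c * cnj c = 1" "c * c + cnj c * cnj c = 0"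
    by (simp_all add: c_def complex_eq_iff real_div_sqrt)
  have sy: "star y = r + cnj c *\<^sub>C k"
    by (simp add: y_def star_add star_scaleC r k)
  have "norm ((1/2) *\<^sub>R ((r + k) * (r + k)) + (1 - 1/2) *\<^sub>R ((r - k) * (r - k))) \<le> 1"
    by (intro norm_convex_le_one norm_mult_le_one le) simp_all
  also have "(1/2) *\<^sub>R ((r + k) * (r + k)) + (1 - 1/2) *\<^sub>R ((r - k) * (r - k)) = r + k * k"
    unfolding ex1 ex2 by (simp add: scaleR_add_right scaleR_diff_right flip: scaleR_add_left)
      (simp add: algebra_simps flip: scaleR_add_left)
  finally have kk: "norm (r + k * k) \<le> 1" .
  \<comment> \<open>\<open>star y * y\<close> equals \<open>r + sqrt 2 k + k * k\<close>. The weight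
    \<open>1 / sqrt 2\<close> turns the linear term \<open>2 k\<close> of the first square into
    \<open>sqrt 2 k\<close>.\<close>
  have "norm ((1 / sqrt 2) *\<^sub>R ((r + k) * (r + k)) + (1 - 1 / sqrt 2) *\<^sub>R (r + k * k)) \<le> 1"
    by (intro norm_convex_le_one norm_mult_le_one le kk) simp_all
  also have "(1 / sqrt 2) *\<^sub>R ((r + k) * (r + k)) + (1 - 1 / sqrt 2) *\<^sub>R (r + k * k)
      = star y * y"
    unfolding sy unfolding y_def ex ex1
    using c by (simp add: algebra_simps scaleC_one scaleC_of_real real_div_sqrt)
  finally have "norm y \<le> 1"
    using cstar_identity[of y] power2_le_iff_abs_le[of 1 "norm y"] by simp
  then have "norm ((1/2) *\<^sub>R (y * y) + (1 - 1/2) *\<^sub>R (star y * star y)) \<le> 1"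
    by (intro norm_convex_le_one norm_mult_le_one) (simp_all add: norm_star)
  also have "(1/2) *\<^sub>R (y * y) + (1 - 1/2) *\<^sub>R (star y * star y)
      = (1/2) *\<^sub>R (y * y + star y * star y)"
    by (simp add: scaleR_add_right)
  also have "y * y + star y * star y
      = (r + r) + 2 *\<^sub>R ((c + cnj c) *\<^sub>C k) + (c * c + cnj c * cnj c) *\<^sub>C (k * k)"
    unfolding sy unfolding y_def ex
    by (simp only: scaleC_add_left scaleR_add_right scaleR_2 add_ac)
  also have "\<dots> = 2 *\<^sub>R (r + sqrt 2 *\<^sub>R k)"
    unfolding c scaleC_of_real by (simp add: scaleR_2 flip: scaleR_add_left)
  finally show ?thesis by simp
qed

text \<open>Iterating the previous step shows that both bounds survive when \<open>k\<close> is
  multiplied by any power of \<open>sqrt 2\<close>; these multiples stay bounded only if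
  \<open>k\<close> vanishes.\<close>

lemma corner_unit_extreme:
  fixes r k :: "'a::cstar"
  assumes r: "star r = r" "r * r = r" and k: "star k = k" "r * k = k" "k * r = k"
    and le: "norm (r + k) \<le> 1" "norm (r - k) \<le> 1"
  shows "k = 0"
proof -
  have *: "norm (r + sqrt 2 ^ n *\<^sub>R k) \<le> 1 \<and> norm (r - sqrt 2 ^ n *\<^sub>R k) \<le> 1" for n
  proof (induction n)
    case (Suc n)
    define l where "l = sqrt 2 ^ n *\<^sub>R k"
    have l: "star l = l" "r * l = l" "l * r = l" "norm (r + l) \<le> 1" "norm (r - l) \<le> 1"
      using k Suc by (simp_all add: l_def star_scaleR)
    \<comment> \<open>The step applied to \<open>- l\<close> gives the bound for the
      difference.\<close>
    have l': "star (- l) = - l" "r * (- l) = - l" "(- l) * r = - l"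
        "norm (r + (- l)) \<le> 1" "norm (r - (- l)) \<le> 1"
      using l linear_neg[OF linear_star, of l] by simp_all
    show ?case
      using corner_unit_step[OF r l] corner_unit_step[OF r l'] by (simp add: l_def)
  qed (use le in simp)
  have bound: "sqrt 2 ^ n * norm k \<le> 1" for n
  proof -
    define l where "l = sqrt 2 ^ n *\<^sub>R k"
    have "2 *\<^sub>R l = (r + l) - (r - l)"
      by (simp only: scaleR_2) simp
    then have "2 * norm l = norm ((r + l) - (r - l))"
      by (metis norm_scaleR abs_numeral)
    moreover have "norm ((r + l) - (r - l)) \<le> 1 + 1"
      using norm_triangle_ineq4[of "r + l" "r - l"] *[of n] unfolding l_def[symmetric] by linarith
    ultimately have "norm l \<le> 1"
      by linarith
    then show ?thesis by (simp add: l_def)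
  qed
  show ?thesis
  proof (rule ccontr)
    assume "k \<noteq> 0"
    obtain n where "inverse (norm k) < sqrt 2 ^ n"
      using real_arch_pow[of "sqrt 2" "inverse (norm k)"] by auto
    then have "1 < sqrt 2 ^ n * norm k"
      using \<open>k \<noteq> 0\<close> by (simp add: inverse_eq_divide pos_divide_less_eq)
    then show False using bound[of n] by simp
  qed
qed

text \<open>In the corner of \<open>r = q e\<close>, compression of \<open>p\<close> gives
  \<open>r\<close> plus half of \<open>H\<close>, where \<open>H\<close> is twice the sum of the
  other compressed summands. Reflection bounds show that \<open>r + H / n\<close> and
  \<open>r - H / n\<close> have norm at most 1, where \<open>n\<close> counts the summands;
  extremality of \<open>r\<close> then forces \<open>H = 0\<close>.\<close>

lemma projection_summand:
  fixes q :: "'i \<Rightarrow> 'a::cstar"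
  assumes fin: "finite F" and e: "e \<in> F"
    and q: "\<And>f. f \<in> F \<Longrightarrow> star (q f) = q f \<and> q f * q f = q f"
    and p: "star p = p" "p * p = p" and sum: "p = (\<Sum>f\<in>F. q f)"
  shows "p * q e = q e"
proof -
  define r where "r = q e"
  have r: "star r = r" "r * r = r" using q e by (auto simp: r_def)
  define n where "n = real (card F)"
  have n: "n > 0" using fin e by (auto simp: n_def card_gt_0_iff)
  define H where "H = 2 *\<^sub>R (\<Sum>f\<in>F - {e}. r * q f * r)"
  have p': "p = r + (\<Sum>f\<in>F - {e}. q f)"
    unfolding sum r_def by (rule sum.remove[OF fin e])
  have rpr: "2 *\<^sub>R (r * p * r) = 2 *\<^sub>R r + H"
    unfolding p' H_def
    by (simp add: distrib_left distrib_right r scaleR_add_right sum_distrib_left sum_distrib_right)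
  \<comment> \<open>\<open>r + H\<close> is minus the compressed reflection in
    \<open>p\<close>.\<close>
  have "norm (r + H) \<le> 1"
    using norm_compressed_reflection_le_one[OF p r] norm_minus_cancel[of "r + H"]
    unfolding rpr by (simp add: scaleR_2)
  have cardF: "real (card (F - {e})) = n - 1"
    using fin e n by (simp add: n_def of_nat_diff)
  have eq: "(n - 1) *\<^sub>R r + (r + H) = n *\<^sub>R r + H"
    by (simp add: scaleR_left_diff_distrib)
  have "norm ((n - 1) *\<^sub>R r) \<le> n - 1"
    using norm_projection_le_one[OF r] mult_left_le[of "norm r" "n - 1"] cardF[symmetric] by simp
  then have plus: "norm (n *\<^sub>R r + H) \<le> n"
    using norm_triangle_ineq[of "(n - 1) *\<^sub>R r" "r + H"] \<open>norm (r + H) \<le> 1\<close>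
    unfolding eq by linarith
  \<comment> \<open>\<open>r + G\<close> is \<open>n r - H\<close> split into \<open>n\<close> terms
    of norm at most 1: \<open>r\<close> itself and one compressed reflection for each other
    summand.\<close>
  define G where "G = (\<Sum>f\<in>F - {e}. r - 2 *\<^sub>R (r * q f * r))"
  have "norm G \<le> (\<Sum>f\<in>F - {e}. 1)"
    unfolding G_def
    by (rule order_trans[OF norm_sum sum_mono])
      (use q in \<open>auto intro!: norm_compressed_reflection_le_one r\<close>)
  then have "norm (r + G) \<le> n"
    using norm_triangle_ineq[of r G] norm_projection_le_one[OF r] cardF by simp
  moreover have "G = (n - 1) *\<^sub>R r - H"
    unfolding G_def H_def sum_subtractf scaleR_sum_right sum_constant_scaleR cardF ..
  ultimately have minus: "norm (n *\<^sub>R r - H) \<le> n"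
    by (simp add: scaleR_left_diff_distrib)
  define k where "k = (1 / n) *\<^sub>R H"
  have H: "H = n *\<^sub>R k" using n by (simp add: k_def)
  have "k = 0"
  proof (rule corner_unit_extreme[OF r])
    have sa: "star (\<Sum>f\<in>F - {e}. r * q f * r) = (\<Sum>f\<in>F - {e}. r * q f * r)"
      unfolding linear_sum[OF linear_star]
      by (intro sum.cong) (simp_all add: star_mult r q mult.assoc)
    show "star k = k" by (simp add: k_def H_def star_scaleR sa)
    show "r * k = k" "k * r = k"
      by (simp_all add: k_def H_def sum_distrib_left sum_distrib_right r flip: mult.assoc)
        (simp add: mult.assoc r)
    have "norm (n *\<^sub>R (r + k)) \<le> n" "norm (n *\<^sub>R (r - k)) \<le> n"
      using plus minus unfolding H scaleR_add_right scaleR_diff_right by auto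
    then show "norm (r + k) \<le> 1" "norm (r - k) \<le> 1" using n by simp_all
  qed
  then have rpr': "r * p * r = r" using rpr H by simp
  have pp: "p * (p * r) = p * r" using p by (simp flip: mult.assoc)
  \<comment> \<open>The product expands to \<open>r - r * p * r\<close>.\<close>
  have "star (r - p * r) * (r - p * r) = 0"
    using p r rpr' pp by (simp add: star_diff star_mult algebra_simps)
  then have "r - p * r = 0" using cstar_identity[of "r - p * r"] by simp
  then show ?thesis by (simp add: r_def)
qed

section \<open>Spectral subspaces of the gauge action\<close>

lemma circle_action_mult:
  "\<lbrakk>circle_action \<alpha>; z \<in> circle\<rbrakk> \<Longrightarrow> \<alpha> z (x * y) = \<alpha> z x * \<alpha> z y"
  unfolding circle_action_def star_hom_def by (simp add: type_algebra_def)

lemma circle_action_star: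
  "\<lbrakk>circle_action \<alpha>; z \<in> circle\<rbrakk> \<Longrightarrow> \<alpha> z (star x) = star (\<alpha> z x)"
  unfolding circle_action_def star_hom_def by (simp add: type_algebra_def)

definition spectral_subspace :: "(complex \<Rightarrow> 'a \<Rightarrow> 'a::cstar) \<Rightarrow> int \<Rightarrow> 'a set" where
  "spectral_subspace \<alpha> n = {b. \<forall>z\<in>circle. \<alpha> z b = (z powi n) *\<^sub>C b}"

lemma spectral_subspace_mult:
  assumes "circle_action \<alpha>" "a \<in> spectral_subspace \<alpha> m" "b \<in> spectral_subspace \<alpha> n"
  shows "a * b \<in> spectral_subspace \<alpha> (m + n)"
proof -
  have "\<alpha> z (a * b) = (z powi (m + n)) *\<^sub>C (a * b)" if "z \<in> circle" for z
  proof -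
    have "z \<noteq> 0" using that by auto
    then show ?thesis
      using assms that
      by (simp add: circle_action_mult spectral_subspace_def scaleC_mult_left scaleC_mult_right
          power_int_add mult.commute)
  qed
  then show ?thesis by (simp add: spectral_subspace_def)
qed

lemma spectral_subspace_star:
  assumes "circle_action \<alpha>" "b \<in> spectral_subspace \<alpha> n"
  shows "star b \<in> spectral_subspace \<alpha> (- n)"
proof -
  have "\<alpha> z (star b) = (z powi (- n)) *\<^sub>C star b" if z: "z \<in> circle" for z
  proof -
    have "z * cnj z = 1" using z by (simp add: complex_norm_square[symmetric])
    then have "cnj z = inverse z" by (metis inverse_unique)
    then have "cnj (z powi n) = z powi (- n)"
      by (simp add: power_int_def power_inverse)
    then show ?thesis
      using assms z by (simp add: circle_action_star spectral_subspace_def star_scaleC)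
  qed
  then show ?thesis by (simp add: spectral_subspace_def)
qed

text \<open>The left factor is arbitrary, which makes this a left ideal. Its generators are the
  coefficients \<open>a * b\<close> of those functions \<open>product_function \<alpha> a b\<close>
  that are monomials of degree \<open>n\<close>.\<close>

definition spectral_ideal :: "(complex \<Rightarrow> 'a \<Rightarrow> 'a::cstar) \<Rightarrow> int \<Rightarrow> 'a set" where
  "spectral_ideal \<alpha> n = cspan {a * b | a b. b \<in> spectral_subspace \<alpha> n}"

lemma subspace_spectral_ideal: "complex_vector.subspace (spectral_ideal \<alpha> n)"
  unfolding spectral_ideal_def by (rule complex_vector.subspace_span)

lemma spectral_idealI: "b \<in> spectral_subspace \<alpha> n \<Longrightarrow> a * b \<in> spectral_ideal \<alpha> n"
  unfolding spectral_ideal_def by (auto intro: complex_vector.span_base)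

text \<open>The right factor of a generator absorbs \<open>b\<close>, and degrees add. This lets an
  edge move the degree by one.\<close>

lemma spectral_ideal_mult_right:
  assumes \<alpha>: "circle_action \<alpha>" and x: "x \<in> spectral_ideal \<alpha> n" and b: "b \<in> spectral_subspace \<alpha> m"
  shows "x * b \<in> spectral_ideal \<alpha> (n + m)"
  using x unfolding spectral_ideal_def[of \<alpha> n]
proof (induction rule: complex_vector.span_induct)
  \<comment> \<open>In \<open>span_induct\<close> the case \<open>base\<close> asks that the
    predicate define a subspace; \<open>step\<close> treats the generators.\<close>
  case base
  show ?case
    using subspace_spectral_ideal[of \<alpha> "n + m"]
    by (simp add: complex_vector.subspace_def distrib_right scaleC_mult_left)
next
  case (step x)
  then obtain a c where "x = a * c" "c \<in> spectral_subspace \<alpha> n" by blast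
  then show ?case
    using spectral_idealI[OF spectral_subspace_mult[OF \<alpha> _ b]] by (simp add: mult.assoc)
qed

lemma spectral_ideal_mult_left:
  assumes "x \<in> spectral_ideal \<alpha> n"
  shows "a * x \<in> spectral_ideal \<alpha> n"
  using assms unfolding spectral_ideal_def[of \<alpha> n]
proof (induction rule: complex_vector.span_induct)
  case base
  show ?case
    using complex_vector.subspace_span[of "{a * b | a b. b \<in> spectral_subspace \<alpha> n}"]
    by (simp add: complex_vector.subspace_def distrib_left scaleC_mult_right)
next
  case (step x)
  then obtain b c where "x = b * c" "c \<in> spectral_subspace \<alpha> n" by blast
  then show ?case
    using spectral_idealI[of c \<alpha> n "a * b"] by (simp add: mult.assoc spectral_ideal_def)
qed

section \<open>Cuntz-Krieger relations and density of the spectral ideals\<close>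

lemma cuntz_krieger_familyD:
  fixes s :: "'e \<Rightarrow> 'a::cstar"
  assumes "cuntz_krieger_family E type_algebra s p"
  shows "v \<in> verts E \<Longrightarrow> p v * p v = p v" "v \<in> verts E \<Longrightarrow> star (p v) = p v"
    and "e \<in> arcs E \<Longrightarrow> s e * star (s e) * s e = s e"
    and "e \<in> arcs E \<Longrightarrow> star (s e) * s e = p (head E e)"
    and "\<lbrakk>v \<in> verts E; out_arcs E v \<noteq> {}\<rbrakk> \<Longrightarrow> p v = (\<Sum>e\<in>out_arcs E v. s e * star (s e))"
proof -
  note CK = assms[unfolded cuntz_krieger_family_type_algebra]
  show "p v * p v = p v" "star (p v) = p v" if "v \<in> verts E"
    using bspec[OF CK[THEN conjunct1] that] by simp_all
  note CK = CK[THEN conjunct2, THEN conjunct2]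
  show "s e * star (s e) * s e = s e" if "e \<in> arcs E"
    using bspec[OF CK[THEN conjunct1] that] .
  note CK = CK[THEN conjunct2]
  show "star (s e) * s e = p (head E e)" if "e \<in> arcs E"
    using bspec[OF CK[THEN conjunct1] that] .
  show "p v = (\<Sum>e\<in>out_arcs E v. s e * star (s e))" if "v \<in> verts E" "out_arcs E v \<noteq> {}"
    using bspec[OF CK[THEN conjunct2] that(1), rule_format, OF that(2)] .
qed

lemma cuntz_krieger_head:
  fixes s :: "'e \<Rightarrow> 'a::cstar"
  assumes "cuntz_krieger_family E type_algebra s p" "e \<in> arcs E"
  shows "s e * p (head E e) = s e"
  using cuntz_krieger_familyD(3,4)[OF assms] by (simp only: mult.assoc)

text \<open>The range projection \<open>s e * star (s e)\<close> is a summand of the finite sum that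
  equals the vertex projection, hence is fixed by it; multiply by \<open>s e\<close> on the
  right.\<close>

lemma cuntz_krieger_tail:
  fixes s :: "'e \<Rightarrow> 'a::cstar"
  assumes wf: "wf_digraph E" and lf: "locally_finite_digraph E"
    and CK: "cuntz_krieger_family E type_algebra s p" and e: "e \<in> arcs E"
  shows "p (tail E e) * s e = s e"
proof -
  interpret wf_digraph E by fact
  let ?v = "tail E e"
  have v: "?v \<in> verts E" and eF: "e \<in> out_arcs E ?v" using e by auto
  have "p ?v * (s e * star (s e)) = s e * star (s e)"
  proof (rule projection_summand[where q = "\<lambda>f. s f * star (s f)", OF _ eF])
    show "finite (out_arcs E ?v)" using lf v by (simp add: locally_finite_digraph_def)
    show "star (p ?v) = p ?v" "p ?v * p ?v = p ?v"
      by (rule cuntz_krieger_familyD(1,2)[OF CK v])+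
    show "p ?v = (\<Sum>f\<in>out_arcs E ?v. s f * star (s f))"
      using cuntz_krieger_familyD(5)[OF CK v] eF by blast
    show "star (s f * star (s f)) = s f * star (s f) \<and>
        s f * star (s f) * (s f * star (s f)) = s f * star (s f)" if "f \<in> out_arcs E ?v" for f
    proof -
      have "f \<in> arcs E" using that by simp
      note D = cuntz_krieger_familyD(3)[OF CK this]
      have "s f * star (s f) * (s f * star (s f)) = s f * star (s f) * s f * star (s f)"
        by (simp only: mult.assoc)
      then have "s f * star (s f) * (s f * star (s f)) = s f * star (s f)" unfolding D .
      then show ?thesis by (simp add: star_mult star_star)
    qed
  qed
  then have "p ?v * (s e * star (s e)) * s e = s e * star (s e) * s e" by (simp only:)
  then show ?thesis
    using cuntz_krieger_familyD(3)[OF CK e] by (simp only: mult.assoc)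
qed

text \<open>
  Going up in the degree uses an edge that ends in \<open>v\<close> and \<open>p v = star (s e) * s e\<close>; going down
  uses all the edges that start in \<open>v\<close> and \<open>p v = (\<Sum>e. s e * star (s e))\<close>.
\<close>

lemma mult_vertex_in_spectral_ideal:
  fixes s :: "'e \<Rightarrow> 'a::cstar"
  assumes wf: "wf_digraph E" and lf: "locally_finite_digraph E"
    and sink: "\<nexists>v. is_sink E v" and source: "\<nexists>v. is_source E v"
    and CK: "cuntz_krieger_family E type_algebra s p" and \<gamma>: "gauge_action E s p \<gamma>"
    and v: "v \<in> verts E"
  shows "x * p v \<in> spectral_ideal \<gamma> n"
proof -
  interpret wf_digraph E by fact
  have act: "circle_action \<gamma>" using \<gamma> by (simp add: gauge_action_def)
  have p: "p v \<in> spectral_subspace \<gamma> 0" if "v \<in> verts E" for v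
    using \<gamma> that by (simp add: gauge_action_def spectral_subspace_def scaleC_one)
  have s: "s e \<in> spectral_subspace \<gamma> 1" if "e \<in> arcs E" for e
    using \<gamma> that by (simp add: gauge_action_def spectral_subspace_def)
  show ?thesis
    using v
  \<comment> \<open>The vertex and \<open>x\<close> are generalised because the induction hypothesis
    is applied at the other end of an edge, with coefficient \<open>x * star (s e)\<close> or
    \<open>x * s e\<close>.\<close>
  proof (induction n arbitrary: v x rule: int_induct[where k = 0])
    case base
    then show ?case using p by (intro spectral_idealI)
  next
    case (step1 n)
    have "in_arcs E v \<noteq> {}" using source step1.prems unfolding is_source_def by blast
    then obtain e where e: "e \<in> arcs E" "head E e = v" unfolding in_arcs_def by blast
    have "x * p v = x * (star (s e) * s e)" using cuntz_krieger_familyD(4)[OF CK e(1)] e(2) by simp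
    also have "\<dots> = x * (star (s e) * (p (tail E e) * s e))"
      using cuntz_krieger_tail[OF wf lf CK e(1)] by simp
    also have "\<dots> = ((x * star (s e)) * p (tail E e)) * s e" by (simp add: mult.assoc)
    finally show ?case
      using spectral_ideal_mult_right[OF act step1.IH s[OF e(1)]] e by simp
  next
    case (step2 n)
    have *: "x * (s e * star (s e)) \<in> spectral_ideal \<gamma> (n - 1)" if e: "e \<in> out_arcs E v" for e
    proof -
      have eE: "e \<in> arcs E" using e by simp
      have "s e * star (s e) = s e * p (head E e) * star (s e)"
        using cuntz_krieger_head[OF CK eE] by simp
      then have "x * (s e * star (s e)) = ((x * s e) * p (head E e)) * star (s e)"
        by (simp add: mult.assoc)
      then show ?thesis
        using spectral_ideal_mult_right[OF act step2.IH spectral_subspace_star[OF act s[OF eE]]] eE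
        by simp
    qed
    have "out_arcs E v \<noteq> {}" using sink step2.prems unfolding is_sink_def by blast
    note sum = cuntz_krieger_familyD(5)[OF CK step2.prems this]
    have "x * p v = (\<Sum>e\<in>out_arcs E v. x * (s e * star (s e)))"
      by (simp only: sum sum_distrib_left)
    then show ?case
      using complex_vector.subspace_sum[OF subspace_spectral_ideal *] by (simp only:)
  qed
qed

text \<open>The closure \<open>L\<close> is a left ideal but not visibly closed under
  \<open>star\<close>. The elements lying in \<open>L\<close> together with their adjoints form a
  closed *-subalgebra \<open>X\<close>: in a product \<open>x * y\<close>, \<open>y\<close> puts the
  product into \<open>L\<close> and \<open>star x\<close> puts its adjoint there. The generators lie
  in \<open>X\<close>, since they and their adjoints are fixed by a vertex projection on the
  right.\<close>

lemma closure_spectral_ideal: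
  fixes s :: "'e \<Rightarrow> 'a::cstar"
  assumes wf: "wf_digraph E" and lf: "locally_finite_digraph E"
    and sink: "\<nexists>v. is_sink E v" and source: "\<nexists>v. is_source E v"
    and G: "graph_cstar_algebra E s p" and \<gamma>: "gauge_action E s p \<gamma>"
  shows "closure (spectral_ideal \<gamma> n) = UNIV"
proof -
  have CK: "cuntz_krieger_family E type_algebra s p"
    and gen: "cstar_generated (s ` arcs E \<union> p ` verts E) = UNIV"
    using G by (auto simp: graph_cstar_algebra_def)
  interpret wf_digraph E by fact
  define L where "L = closure (spectral_ideal \<gamma> n)"
  have sub: "complex_vector.subspace L"
    unfolding L_def by (rule subspace_closure[OF subspace_spectral_ideal])
  have vertex: "x * p v \<in> L" if "v \<in> verts E" for x v
    using mult_vertex_in_spectral_ideal[OF wf lf sink source CK \<gamma> that] closure_subset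
    unfolding L_def by blast
  have left: "a * x \<in> L" if "x \<in> L" for a x
  proof -
    have "(*) a ` closure (spectral_ideal \<gamma> n) \<subseteq> L"
      unfolding L_def
    proof (rule image_closure_subset)
      show "continuous_on (closure (spectral_ideal \<gamma> n)) ((*) a)" by (intro continuous_intros)
      show "(*) a ` spectral_ideal \<gamma> n \<subseteq> closure (spectral_ideal \<gamma> n)"
        using spectral_ideal_mult_left closure_subset by blast
    qed simp
    then show ?thesis using that by (auto simp: L_def)
  qed
  define X where "X = L \<inter> star -` L"
  have "closed X"
    unfolding X_def L_def
    by (intro closed_Int closed_closure continuous_closed_vimage)
      (simp add: linear_continuous_at bounded_linear_star)
  moreover have "complex_vector.subspace X"
    using sub by (simp add: X_def complex_vector.subspace_def star_add star_scaleC)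
  moreover have "\<forall>x\<in>X. \<forall>y\<in>X. x * y \<in> X" "\<forall>x\<in>X. star x \<in> X"
    using left by (auto simp: X_def star_mult star_star)
  moreover have "s e \<in> X" if e: "e \<in> arcs E" for e
  proof -
    have "s e \<in> L"
      using vertex[of "head E e" "s e"] cuntz_krieger_head[OF CK e] e by simp
    moreover have "star (s e) = star (s e) * p (tail E e)"
      using cuntz_krieger_tail[OF wf lf CK e] cuntz_krieger_familyD(2)[OF CK tail_in_verts[OF e]]
        star_mult[of "p (tail E e)" "s e"] by simp
    then have "star (s e) \<in> L" using vertex[of "tail E e" "star (s e)"] e by simp
    ultimately show ?thesis by (simp add: X_def)
  qed
  moreover have "p v \<in> X" if v: "v \<in> verts E" for v
  proof -
    show ?thesis
      using vertex[OF v, of "p v"] cuntz_krieger_familyD(1,2)[OF CK v] by (simp add: X_def)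
  qed
  ultimately have "cstar_generated (s ` arcs E \<union> p ` verts E) \<subseteq> X"
    unfolding cstar_generated_def by (intro Inter_lower) auto
  then show ?thesis using gen by (auto simp: X_def L_def)
qed

section \<open>Trigonometric polynomials with values in a C*-algebra\<close>

text \<open>The value 0 off the circle is what the carrier of \<open>convolution_algebra\<close>
  demands.\<close>

definition monomial :: "int \<Rightarrow> 'a::cstar \<Rightarrow> complex \<Rightarrow> 'a" where
  "monomial n x = (\<lambda>t. if t \<in> circle then (t powi n) *\<^sub>C x else 0)"

lemma monomial_add: "monomial n (x + y) = (\<lambda>t. monomial n x t + monomial n y t)"
  by (auto simp: monomial_def scaleC_add_right)

lemma monomial_scaleC: "monomial n (c *\<^sub>C x) = (\<lambda>t. c *\<^sub>C monomial n x t)"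
  by (auto simp: monomial_def scaleC_scaleC mult.commute)

lemma norm_monomial: "t \<in> circle \<Longrightarrow> norm (monomial n x t) = norm x"
  by (simp add: monomial_def norm_scaleC norm_power_int)

lemma continuous_on_monomial: "continuous_on circle (monomial n x)"
proof -
  have "continuous_on circle (\<lambda>t. (t powi n) *\<^sub>C x)"
    by (intro continuous_intros) auto
  then show ?thesis by (rule continuous_on_eq) (simp add: monomial_def)
qed

inductive_set trig_polynomials :: "(complex \<Rightarrow> 'a::cstar) set" where
  monomial: "monomial n x \<in> trig_polynomials"
| add: "\<lbrakk>f \<in> trig_polynomials; g \<in> trig_polynomials\<rbrakk> \<Longrightarrow> (\<lambda>t. f t + g t) \<in> trig_polynomials"

lemma trig_polynomials_scaleR:
  "f \<in> trig_polynomials \<Longrightarrow> (\<lambda>t. c *\<^sub>R f t) \<in> trig_polynomials"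
proof (induction rule: trig_polynomials.induct)
  case (monomial n x)
  have "(\<lambda>t. c *\<^sub>R monomial n x t) = monomial n (c *\<^sub>R x)"
    using monomial_scaleC[of n "of_real c" x] by (simp only: scaleC_of_real)
  then show ?case by (simp only: trig_polynomials.monomial)
qed (simp add: scaleR_add_right trig_polynomials.add)

lemma trig_polynomials_sum:
  "(\<And>i. i \<in> I \<Longrightarrow> f i \<in> trig_polynomials) \<Longrightarrow> (\<lambda>t. \<Sum>i\<in>I. f i t) \<in> trig_polynomials"
proof (induction I rule: infinite_finite_induct)
  case (insert i I)
  then show ?case by (simp add: trig_polynomials.add)
\<comment> \<open>The zero function, the value of empty and infinite sums, is
  \<open>monomial 0 0\<close>.\<close>
qed (use trig_polynomials.monomial[of 0 0] in \<open>simp_all add: monomial_def cong: if_cong\<close>)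

text \<open>On the circle \<open>cnj t = inverse t\<close>, so \<open>Re t\<close> and
  \<open>Im t\<close> are combinations of \<open>t\<close> and \<open>inverse t\<close>; multiplying
  by them shifts degrees by 1 and -1.\<close>

lemma trig_polynomials_Re_Im:
  assumes "f \<in> trig_polynomials"
  shows "(\<lambda>t. Re t *\<^sub>R f t) \<in> trig_polynomials" "(\<lambda>t. Im t *\<^sub>R f t) \<in> trig_polynomials"
proof -
  have "(\<lambda>t. Re t *\<^sub>R f t) \<in> trig_polynomials \<and> (\<lambda>t. Im t *\<^sub>R f t) \<in> trig_polynomials"
    using assms
  proof (induction rule: trig_polynomials.induct)
    case (monomial n x)
    define k :: complex where "k = inverse (2 * \<i>)"
    have RI: "of_real (Re t) * t powi n = t powi (n + 1) * inverse 2 + t powi (n - 1) * inverse 2"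
      "of_real (Im t) * t powi n = t powi (n + 1) * k + t powi (n - 1) * (- k)"
      if t: "t \<in> circle" for t
    proof -
      have t0: "t \<noteq> 0" using t by auto
      have "t * cnj t = 1" using t by (simp add: complex_norm_square[symmetric])
      then have c: "cnj t = inverse t" by (metis inverse_unique)
      have R: "of_real (Re t) = (t + inverse t) * inverse 2"
        using complex_add_cnj[of t] by (simp add: c)
      have "of_real (Im t) = (t - inverse t) / (2 * \<i>)"
        using complex_diff_cnj[of t] by (intro eq_divide_imp) (simp_all add: c)
      then have I: "of_real (Im t) = (t - inverse t) * k"
        by (simp only: k_def divide_inverse)
      have P: "t powi (n + 1) = t powi n * t" "t powi (n - 1) = t powi n * inverse t"
        using t0 by (simp_all add: power_int_add power_int_diff divide_inverse)
      have alg: "(a + b) * u * P = P * a * u + P * b * u" "(a - b) * u * P = P * a * u + P * b * (- u)"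
        for a b u P :: complex by (simp_all add: algebra_simps)
      show "of_real (Re t) * t powi n = t powi (n + 1) * inverse 2 + t powi (n - 1) * inverse 2"
        "of_real (Im t) * t powi n = t powi (n + 1) * k + t powi (n - 1) * (- k)"
        unfolding P R I by (rule alg)+
    qed
    have "Re t *\<^sub>R monomial n x t
        = monomial (n + 1) (inverse 2 *\<^sub>C x) t + monomial (n - 1) (inverse 2 *\<^sub>C x) t"
      "Im t *\<^sub>R monomial n x t
        = monomial (n + 1) (k *\<^sub>C x) t + monomial (n - 1) ((- k) *\<^sub>C x) t" for t
    proof (atomize (full), cases "t \<in> circle")
      case True
      then show "Re t *\<^sub>R monomial n x t
          = monomial (n + 1) (inverse 2 *\<^sub>C x) t + monomial (n - 1) (inverse 2 *\<^sub>C x) t \<and>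
        Im t *\<^sub>R monomial n x t
          = monomial (n + 1) (k *\<^sub>C x) t + monomial (n - 1) ((- k) *\<^sub>C x) t"
        by (simp only: monomial_def if_True scaleC_of_real[symmetric] scaleC_scaleC RI
            scaleC_add_left simp_thms)
    qed (simp add: monomial_def)
    then have eq: "(\<lambda>t. Re t *\<^sub>R monomial n x t)
        = (\<lambda>t. monomial (n + 1) (inverse 2 *\<^sub>C x) t + monomial (n - 1) (inverse 2 *\<^sub>C x) t)"
      "(\<lambda>t. Im t *\<^sub>R monomial n x t)
        = (\<lambda>t. monomial (n + 1) (k *\<^sub>C x) t + monomial (n - 1) ((- k) *\<^sub>C x) t)"
      by blast+
    show ?case unfolding eq by (intro conjI trig_polynomials.intros)
  qed (simp_all add: scaleR_add_right trig_polynomials.add)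
  then show "(\<lambda>t. Re t *\<^sub>R f t) \<in> trig_polynomials" "(\<lambda>t. Im t *\<^sub>R f t) \<in> trig_polynomials"
    by simp_all
qed

text \<open>A real-linear functional on the plane is \<open>q 1 * Re t + q \<i> * Im t\<close>,
  which reduces to the previous lemma. Generalising \<open>f\<close> lets a product of polynomials
  act one factor at a time.\<close>

lemma trig_polynomials_real_polynomial:
  assumes "real_polynomial_function q" "f \<in> trig_polynomials"
  shows "(\<lambda>t. q t *\<^sub>R f t) \<in> trig_polynomials"
  using assms
proof (induction arbitrary: f rule: real_polynomial_function.induct)
  case (linear q)
  have "q t *\<^sub>R f t = q 1 *\<^sub>R (Re t *\<^sub>R f t) + q \<i> *\<^sub>R (Im t *\<^sub>R f t)" for t
  proof -
    have "t = Re t *\<^sub>R 1 + Im t *\<^sub>R \<i>" by (simp add: complex_eq_iff)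
    then have "q t = Re t * q 1 + Im t * q \<i>"
      using linear_add[OF bounded_linear.linear[OF linear.hyps], of "Re t *\<^sub>R 1" "Im t *\<^sub>R \<i>"]
        linear_scale[OF bounded_linear.linear[OF linear.hyps]] by (simp only: real_scaleR_def)
    then show ?thesis by (simp add: scaleR_add_left mult.commute)
  qed
  then have "(\<lambda>t. q t *\<^sub>R f t) = (\<lambda>t. q 1 *\<^sub>R (Re t *\<^sub>R f t) + q \<i> *\<^sub>R (Im t *\<^sub>R f t))"
    by blast
  then show ?case
    using linear.prems
    by (simp only: trig_polynomials.add trig_polynomials_scaleR trig_polynomials_Re_Im)
next
  case (mult q r)
  then have "(\<lambda>t. q t *\<^sub>R (r t *\<^sub>R f t)) \<in> trig_polynomials" by blast
  then show ?case by simp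
qed (simp_all add: trig_polynomials_scaleR scaleR_add_left trig_polynomials.add)

text \<open>
  A partition of unity reduces the approximation to that of scalar functions.
\<close>

lemma trig_polynomials_dense:
  fixes f :: "complex \<Rightarrow> 'a::cstar"
  assumes f: "continuous_on circle f" and e: "e > 0"
  shows "\<exists>g\<in>trig_polynomials. \<forall>t\<in>circle. norm (f t - g t) \<le> e"
proof -
  have comp: "compact circle" by simp
  obtain d where d: "d > 0"
    "\<And>x y. \<lbrakk>x \<in> circle; y \<in> circle; dist y x < d\<rbrakk> \<Longrightarrow> dist (f y) (f x) < e / 2"
    using compact_uniformly_continuous[OF f comp] e unfolding uniformly_continuous_on_def
    by (meson half_gt_zero)
  have "circle \<subseteq> (\<Union>c\<in>circle. ball c d)" using d(1) by (auto intro!: centre_in_ball[THEN iffD2])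
  then obtain C where C: "C \<subseteq> circle" "finite C" "circle \<subseteq> (\<Union>c\<in>C. ball c d)"
    by (rule compactE_image[OF comp open_ball])
  \<comment> \<open>A tent function, positive exactly on \<open>ball c d\<close>. The balls cover
    the circle, so the sum \<open>W\<close> is positive there and can normalise the weights.\<close>
  define w where "w c t = max 0 (d - dist c t)" for c t :: complex
  define W where "W t = (\<Sum>c\<in>C. w c t)" for t
  have w: "w c t \<ge> 0" for c t by (simp add: w_def)
  have W: "W t > 0" if t: "t \<in> circle" for t
  proof -
    obtain c where "c \<in> C" "t \<in> ball c d" using C(3) t by blast
    then have "c \<in> C" "w c t > 0" by (auto simp: w_def)
    then show ?thesis unfolding W_def using C(2) w by (intro sum_pos2) auto
  qed
  define \<phi> where "\<phi> c t = w c t / W t" for c t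
  have \<phi>: "\<phi> c t \<ge> 0" if "t \<in> circle" for c t
    using W[OF that] w by (simp add: \<phi>_def)
  have \<phi>1: "(\<Sum>c\<in>C. \<phi> c t) = 1" if "t \<in> circle" for t
    using W[OF that] by (simp add: \<phi>_def W_def flip: sum_divide_distrib)
  have \<phi>_cont: "continuous_on circle (\<phi> c)" for c
    unfolding \<phi>_def by (intro continuous_intros ballI W[THEN less_imp_neq, symmetric])
      (auto simp: W_def w_def intro!: continuous_intros)
  have near: "norm (f t - (\<Sum>c\<in>C. \<phi> c t *\<^sub>R f c)) \<le> e / 2" if t: "t \<in> circle" for t
  proof -
    have "f t - (\<Sum>c\<in>C. \<phi> c t *\<^sub>R f c) = (\<Sum>c\<in>C. \<phi> c t *\<^sub>R (f t - f c))"
      using \<phi>1[OF t] by (simp add: scaleR_diff_right sum_subtractf flip: scaleR_sum_left)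
    also have "norm \<dots> \<le> (\<Sum>c\<in>C. \<phi> c t * (e / 2))"
    proof (rule sum_norm_le)
      fix c assume c: "c \<in> C"
      show "norm (\<phi> c t *\<^sub>R (f t - f c)) \<le> \<phi> c t * (e / 2)"
      \<comment> \<open>Either uniform continuity applies, or the weight \<open>\<phi> c t\<close>
        is 0.\<close>
      proof (cases "dist c t < d")
        case True
        then have "norm (f t - f c) \<le> e / 2"
          using d(2)[of c t] subsetD[OF C(1) c] t by (simp add: dist_norm norm_minus_commute)
        then have "\<phi> c t * norm (f t - f c) \<le> \<phi> c t * (e / 2)"
          by (rule mult_left_mono[OF _ \<phi>[OF t]])
        then show ?thesis using \<phi>[OF t, of c] by (simp only: norm_scaleR abs_of_nonneg)
      qed (simp add: \<phi>_def w_def)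
    qed
    also have "\<dots> = e / 2" using \<phi>1[OF t] by (simp flip: sum_distrib_right sum_divide_distrib)
    finally show ?thesis .
  qed
  define S where "S = (\<Sum>c\<in>C. norm (f c))"
  have S: "S \<ge> 0" by (simp add: S_def sum_nonneg)
  \<comment> \<open>Chosen so that \<open>h * S \<le> e / 2\<close>; the summand 1 keeps the
    denominator positive when all \<open>f c\<close> vanish.\<close>
  define h where "h = e / (2 * (S + 1))"
  have h: "h > 0" using e S by (simp add: h_def)
  have "\<exists>q. real_polynomial_function q \<and> (\<forall>t\<in>circle. \<bar>\<phi> c t - q t\<bar> < h)" for c
    using Stone_Weierstrass_real_polynomial_function[OF comp \<phi>_cont h] by metis
  then obtain q where q: "\<And>c. real_polynomial_function (q c)"
    "\<And>c t. t \<in> circle \<Longrightarrow> \<bar>\<phi> c t - q c t\<bar> < h" by metis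
  \<comment> \<open>On the circle \<open>monomial 0 (f c)\<close> is the constant
    \<open>f c\<close>.\<close>
  define g where "g t = (\<Sum>c\<in>C. q c t *\<^sub>R monomial 0 (f c) t)" for t
  have "g \<in> trig_polynomials"
    unfolding g_def
    by (intro trig_polynomials_sum trig_polynomials_real_polynomial q trig_polynomials.monomial)
  moreover have "norm (f t - g t) \<le> e" if t: "t \<in> circle" for t
  proof -
    have "(\<Sum>c\<in>C. \<phi> c t *\<^sub>R f c) - g t = (\<Sum>c\<in>C. (\<phi> c t - q c t) *\<^sub>R f c)"
      using t by (simp add: g_def monomial_def scaleC_one scaleR_diff_left sum_subtractf)
    also have "norm \<dots> \<le> (\<Sum>c\<in>C. h * norm (f c))"
      by (rule sum_norm_le) (simp add: mult_right_mono less_imp_le[OF q(2)[OF t]])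
    also have "\<dots> = h * S" by (simp add: S_def sum_distrib_left)
    also have "\<dots> \<le> e / 2" using e S by (simp add: h_def field_simps)
    finally show ?thesis
      using norm_triangle_ineq[of "f t - (\<Sum>c\<in>C. \<phi> c t *\<^sub>R f c)" "(\<Sum>c\<in>C. \<phi> c t *\<^sub>R f c) - g t"]
        near[OF t] by simp
  qed
  ultimately show ?thesis by blast
qed

section \<open>Saturation\<close>

text \<open>Haar measure is normalized, so the L1-norm is at most the supremum norm.\<close>

lemma convolution_algebra_norm_le:
  assumes f: "f \<in> carrier (convolution_algebra \<alpha>)" and B: "\<And>t. t \<in> circle \<Longrightarrow> norm (f t) \<le> B"
  shows "anorm (convolution_algebra \<alpha>) f \<le> B"
proof -
  have "continuous_on circle f" using f by (simp add: convolution_algebra_def)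
  moreover have "continuous_on {0..1} (\<lambda>x. cis (2 * pi * x))" by (intro continuous_intros)
  ultimately have "continuous_on {0..1} (\<lambda>x. norm (f (cis (2 * pi * x))))"
    by (intro continuous_on_norm) (rule continuous_on_compose2, auto)
  then have "integral {0..1} (\<lambda>x. norm (f (cis (2 * pi * x)))) \<le> integral {0..1::real} (\<lambda>x. B)"
    by (intro integral_le integrable_continuous_interval B) auto
  then show ?thesis by (simp add: convolution_algebra_def circle_integral_def)
qed

lemma monomial_in_carrier: "monomial n x \<in> carrier (convolution_algebra \<alpha>)"
  using continuous_on_monomial by (simp add: convolution_algebra_def) (simp add: monomial_def)

theorem theorem6p3:
  fixes E :: "('v, 'e) pre_digraph"
    and s :: "'e \<Rightarrow> 'a::cstar" and p :: "'v \<Rightarrow> 'a"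
    and \<gamma> :: "complex \<Rightarrow> 'a \<Rightarrow> 'a"
    and \<iota> :: "(complex \<Rightarrow> 'a) \<Rightarrow> 'n::cstar"
  assumes "wf_digraph E"
    and "locally_finite_digraph E"
    and "\<nexists>v. is_sink E v"
    and "\<nexists>v. is_source E v"
    and "graph_cstar_algebra E s p"
    and "gauge_action E s p \<gamma>"
    and "crossed_product \<gamma> \<iota>"
  shows "saturated \<gamma> \<iota>"
proof -
  let ?K = "convolution_algebra \<gamma>"
  have hom: "star_hom ?K type_algebra \<iota>" and L1: "L1_contractive \<gamma> type_algebra \<iota>"
    and dense: "closure (\<iota> ` carrier ?K) = UNIV"
    using assms(7) by (auto simp: crossed_product_def)
  have \<iota>_add: "\<iota> (\<lambda>t. f t + g t) = \<iota> f + \<iota> g" if "f \<in> carrier ?K" "g \<in> carrier ?K" for f g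
  proof -
    have "\<iota> (f \<oplus>\<^bsub>?K\<^esub> g) = \<iota> f \<oplus>\<^bsub>type_algebra\<^esub> \<iota> g"
      using hom that unfolding star_hom_def by blast
    then show ?thesis by (simp add: convolution_algebra_def type_algebra_def)
  qed
  have \<iota>_scale: "\<iota> (\<lambda>t. c *\<^sub>C f t) = c *\<^sub>C \<iota> f" if "f \<in> carrier ?K" for f c
  proof -
    have "\<iota> (c \<odot>\<^bsub>?K\<^esub> f) = c \<odot>\<^bsub>type_algebra\<^esub> \<iota> f"
      using hom that unfolding star_hom_def by blast
    then show ?thesis by (simp add: convolution_algebra_def type_algebra_def)
  qed
  have \<iota>_norm: "norm (\<iota> f) \<le> B"
    if "f \<in> carrier ?K" "\<And>t. t \<in> circle \<Longrightarrow> norm (f t) \<le> B" for f B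
  proof -
    have "norm (\<iota> f) \<le> anorm ?K f"
      using L1 that(1) by (simp add: L1_contractive_def type_algebra_def)
    also have "\<dots> \<le> B" using that by (rule convolution_algebra_norm_le)
    finally show ?thesis .
  qed
  define J where "J = closure (cspan {\<iota> (product_function \<gamma> a b) | a b. True})"
  have J: "complex_vector.subspace J" "closed J"
    unfolding J_def by (simp_all add: subspace_closure complex_vector.subspace_span)
  \<comment> \<open>For fixed \<open>n\<close> the map \<open>F\<close> is linear and contractive,
    as a monomial has constant norm on the circle. The preimage of \<open>J\<close> is thus a closed
    subspace, and it suffices that it contains the generators of the dense
    \<open>spectral_ideal \<gamma> n\<close>.\<close>
  have mono: "\<iota> (monomial n x) \<in> J" for n x
  proof -
    define F where "F = (\<lambda>x. \<iota> (monomial n x))"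
    have F_add: "F (x + y) = F x + F y" and F_scale: "F (c *\<^sub>C x) = c *\<^sub>C F x" for x y c
      by (simp_all add: F_def monomial_add monomial_scaleC \<iota>_add \<iota>_scale monomial_in_carrier)
    have "bounded_linear F"
    proof (rule bounded_linear_intro[where K = 1])
      show "F (r *\<^sub>R x) = r *\<^sub>R F x" for r x using F_scale[of "of_real r" x] by (simp add: scaleC_of_real)
      show "norm (F x) \<le> norm x * 1" for x
        unfolding F_def by (rule \<iota>_norm) (simp_all add: monomial_in_carrier norm_monomial)
    qed (rule F_add)
    then have closed: "closed (F -` J)"
      by (intro continuous_closed_vimage J linear_continuous_at)
    have sub: "complex_vector.subspace (F -` J)"
      using J(1) F_scale[of 0 0] by (simp add: complex_vector.subspace_def F_add F_scale)
    have "a * b \<in> F -` J" if "b \<in> spectral_subspace \<gamma> n" for a b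
    proof -
      have "monomial n (a * b) = product_function \<gamma> a b"
        using that
        by (auto simp: fun_eq_iff monomial_def product_function_def spectral_subspace_def
            scaleC_mult_right)
      moreover have "\<iota> (product_function \<gamma> a b) \<in> J"
        unfolding J_def by (rule subsetD[OF closure_subset]) (auto intro: complex_vector.span_base)
      ultimately show ?thesis by (simp add: F_def)
    qed
    then have "spectral_ideal \<gamma> n \<subseteq> F -` J"
      unfolding spectral_ideal_def by (intro complex_vector.span_minimal sub) auto
    then have "closure (spectral_ideal \<gamma> n) \<subseteq> F -` J" using closed by (rule closure_minimal)
    then show ?thesis
      using closure_spectral_ideal[OF assms(1-6)] by (auto simp: F_def)
  qed
  have trig: "g \<in> carrier ?K \<and> \<iota> g \<in> J" if "g \<in> trig_polynomials" for g
    using that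
  proof (induction rule: trig_polynomials.induct)
    case (add f g)
    then have "(\<lambda>t. f t + g t) \<in> carrier ?K"
      by (simp add: convolution_algebra_def continuous_on_add)
    then show ?case
      using add complex_vector.subspace_add[OF J(1)] by (simp add: \<iota>_add)
  qed (simp add: monomial_in_carrier mono)
  \<comment> \<open>Uniform approximation by trigonometric polynomials carries over, as
    \<open>\<iota>\<close> is bounded by the supremum norm.\<close>
  have "\<iota> f \<in> J" if f: "f \<in> carrier ?K" for f
  proof -
    have "\<iota> f \<in> closure J"
      unfolding closure_approachable
    proof (intro allI impI)
      fix e :: real assume e: "e > 0"
      obtain g where g: "g \<in> trig_polynomials" "\<And>t. t \<in> circle \<Longrightarrow> norm (f t - g t) \<le> e / 2"
        using trig_polynomials_dense[of f "e / 2"] f e by (auto simp: convolution_algebra_def)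
      have gK: "g \<in> carrier ?K" "\<iota> g \<in> J" using trig[OF g(1)] by auto
      \<comment> \<open>\<open>star_hom\<close> speaks of sums and scalar multiples, so the
        difference is formed with the scalar -1.\<close>
      have neg: "(\<lambda>t. (- 1) *\<^sub>C g t) \<in> carrier ?K"
        using gK(1) by (simp add: convolution_algebra_def continuous_intros)
      have "\<iota> (\<lambda>t. f t + (- 1) *\<^sub>C g t) = \<iota> f + (- 1) *\<^sub>C \<iota> g"
        unfolding \<iota>_add[OF f neg] \<iota>_scale[OF gK(1)] ..
      then have "\<iota> (\<lambda>t. f t - g t) = \<iota> f - \<iota> g" by (simp add: scaleC_one)
      moreover have "(\<lambda>t. f t - g t) \<in> carrier ?K"
        using f gK(1) by (simp add: convolution_algebra_def continuous_on_diff)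
      then have "norm (\<iota> (\<lambda>t. f t - g t)) \<le> e / 2" using g(2) by (rule \<iota>_norm)
      ultimately have "dist (\<iota> g) (\<iota> f) < e" using e by (simp add: dist_norm norm_minus_commute)
      then show "\<exists>y\<in>J. dist y (\<iota> f) < e" using gK(2) by blast
    qed
    then show ?thesis using J(2) by simp
  qed
  then have "closure (\<iota> ` carrier ?K) \<subseteq> J" by (intro closure_minimal J(2)) auto
  then show ?thesis using dense by (auto simp: saturated_def J_def)
qed

end
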